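(* Let $\Omega=(x_i,x_f)\subseteq\mathbb R$ be an open interval (bounded or unbounded) and let $f,h$ be probability density functions, both with support $\overline\Omega$ and positive on $\Omega$. Then $$C_{FS,\alpha}^{[h]}\Big[\mathfrak R_\alpha^{-1,[h]}\,\mathfrak C_\tau^G\,\mathfrak R_\alpha^{[h]}[f]\Big]\ \le\ C_{FS,\alpha}^{[h]}[f].$$ Moreover, when $f=\mathfrak R_\alpha^{-1,[h]}[G_\nu]$ for an arbitrary variance $\nu$, equality holds for any value of $\alpha$.
   Context: Relative differential-escort transformation of order $\alpha\in\mathbb R$: $\mathfrak R_\alpha^{[h]}[f](y)=\big(f(x(y))/h(x(y))\big)^\alpha$, where $y'(x)=f(x)^{1-\alpha}h(x)^\alpha$ and $x(y)$ is the inverse function of $y(x)$; it is a probability density in $y$, defined up to a translation. Inverse transformation: it is defined for probability densities $g$ with $r:=N_{1/\alpha^*}[g]<\infty$, where $\frac1{\alpha^*}=\frac{\alpha-1}{\alpha}$ and $N_\gamma[g]=(\int g^\gamma\,dx)^{1/(1-\gamma)}$ (for $\alpha=1$: for $g$ compactly supported, with $r$ the length of its support), by $$\mathfrak R_\alpha^{-1,[h]}[g](x)=[rg(ry(x))]^{1/\alpha}h(x),\qquad y'(x)=[rg(ry(x))]^{-1/\alpha^*}h(x).$$ Gaussian convolution: $G_\tau(x)=\frac1{\sqrt{2\pi\tau}}e^{-x^2/(2\tau)}$ is the Gaussian density with variance $\tau$, and $\mathfrak C^G_\tau[g]=G_\tau*g$. Relative Fisher-Shannon complexity: $C_{FS,\alpha}^{[h]}[f]=C_{FS,\alpha}[f\|h]:=C_{FS}\big(\mathfrak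 R_\alpha^{[h]}[f]\big)$, where $C_{FS}$ is the standard Fisher-Shannon complexity measure, i.e. the product of the Fisher information and the Shannon entropy power, here in the form $C_{FS}[g]=\phi_{2,1}[g]\,N[g]$ with $\phi_{2,1}[g]=\big(\int|g'/g|^2g\,dx\big)^{1/2}$ and $N[g]=\exp(-\int g\log g\,dx)$. In the source this quantity is also written as $$C_{FS,\alpha}^{[h]}[f]=e^{-D[f\|h]}\,\phi_{2,\alpha}[f\|h],$$ with $D[f\|h]=\int_\Omega f\log\frac fh\,dx$ (Kullback-Leibler divergence) and $\phi_{p,\lambda}[f\|h]=\Big(\int_\Omega f^{1+p(\lambda-1)}h^{-\lambda p}\big|\frac d{dx}\log\frac fh\big|^pdx\Big)^{1/(p\lambda)}$ (relative Fisher divergence, for $p>1$, $\lambda\ne0$, $f,h$ differentiable).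
   Formalization: Fisher information is taken as infinite when the transformed density, extended by 0, is not locally absolutely continuous on the line (e.g. f = h, where the literal claim fails); f, h are continuous, and α is such that the inverse transformation is defined. *)

theory Defs
  imports "HOL-Probability.Probability"
begin

section \<open>Probability densities\<close>

definition pdf :: "(real \<Rightarrow> real) \<Rightarrow> bool" where
  "pdf f \<longleftrightarrow> (\<forall>x. 0 \<le> f x) \<and> has_bochner_integral lborel f 1"

definition support :: "(real \<Rightarrow> real) \<Rightarrow> real set" where
  "support f = closure {x. f x \<noteq> 0}"

definition positive_pdf_on :: "real set \<Rightarrow> (real \<Rightarrow> real) \<Rightarrow> bool" where
  "positive_pdf_on \<Omega> f \<longleftrightarrow> pdf f \<and> support f = closure \<Omega> \<and> (\<forall>x\<in>\<Omega>. 0 < f x)"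

section \<open>The relative differential-escort transformation\<close>

text \<open>
  The function \<open>y\<close> is determined on the interval \<open>\<Omega>\<close> by its derivative up to an additive
  constant. The choice operator fixes this constant arbitrarily, so the transformed density is
  fixed up to a translation. (For \<open>f\<close> and \<open>h\<close> continuous and positive on the open interval
  \<open>\<Omega>\<close> such a \<open>y\<close> exists, and it is strictly increasing on \<open>\<Omega>\<close>.)
\<close>

definition escort_coord ::
  "real set \<Rightarrow> (real \<Rightarrow> real) \<Rightarrow> real \<Rightarrow> (real \<Rightarrow> real) \<Rightarrow> real \<Rightarrow> real" where
  "escort_coord \<Omega> h \<alpha> f = (SOME y. \<forall>x\<in>\<Omega>.
     (y has_real_derivative f x powr (1 - \<alpha>) * h x powr \<alpha>) (at x))"

definition rel_escort ::
  "real set \<Rightarrow> (real \<Rightarrow> real) \<Rightarrow> real \<Rightarrow> (real \<Rightarrow> real) \<Rightarrow> real \<Rightarrow> real" where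
  "rel_escort \<Omega> h \<alpha> f t =
     (let y = escort_coord \<Omega> h \<alpha> f; x = inv_into \<Omega> y t
      in if t \<in> y ` \<Omega> then (f x / h x) powr \<alpha> else 0)"

section \<open>The inverse transformation\<close>

text \<open>
  \<open>inv_conj \<alpha>\<close> is the number \<open>1/\<alpha>\<^sup>*\<close>. Since \<open>0 powr a = 0\<close> for every \<open>a\<close>, the integral
  below only runs over the points where \<open>g\<close> is positive.
\<close>

definition inv_conj :: "real \<Rightarrow> real" where
  "inv_conj \<alpha> = (\<alpha> - 1) / \<alpha>"

definition renyi_power :: "real \<Rightarrow> (real \<Rightarrow> real) \<Rightarrow> real" where
  "renyi_power \<gamma> g = (LINT x|lborel. g x powr \<gamma>) powr (1 / (1 - \<gamma>))"

definition inv_scale :: "real \<Rightarrow> (real \<Rightarrow> real) \<Rightarrow> real" where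
  "inv_scale \<alpha> g =
     (if \<alpha> = 1 then measure lborel (support g) else renyi_power (inv_conj \<alpha>) g)"

text \<open>
  The densities on which the inverse transformation is defined. Finiteness of \<open>N\<^bsub>1/\<alpha>*\<^esub>[g]\<close> is
  expressed as finiteness of the integral in it; for \<open>\<alpha> < 0\<close> the outer exponent is negative, and
  a divergent integral would give the meaningless scale \<open>r = 0\<close>.
\<close>

definition inv_escort_defined :: "real \<Rightarrow> (real \<Rightarrow> real) \<Rightarrow> bool" where
  "inv_escort_defined \<alpha> g \<longleftrightarrow> pdf g \<and> \<alpha> \<noteq> 0 \<and>
     (if \<alpha> = 1 then compact (support g) else integrable lborel (\<lambda>x. g x powr inv_conj \<alpha>))"

text \<open>
  The solution \<open>y\<close> has to take its values where the rescaled density \<open>t \<mapsto> r g(r t)\<close> is positive.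
  This density to the power \<open>1/\<alpha>\<^sup>*\<close> and \<open>h\<close> both have total integral 1, so for \<open>g\<close> positive and
  continuous on an open interval the differential equation has exactly one such solution on all
  of \<open>\<Omega>\<close>: no choice is left.
\<close>

definition inv_escort_coord ::
  "real set \<Rightarrow> (real \<Rightarrow> real) \<Rightarrow> real \<Rightarrow> (real \<Rightarrow> real) \<Rightarrow> real \<Rightarrow> real" where
  "inv_escort_coord \<Omega> h \<alpha> g = (let r = inv_scale \<alpha> g in
     SOME y. \<forall>x\<in>\<Omega>. 0 < g (r * y x) \<and>
       (y has_real_derivative (r * g (r * y x)) powr (- inv_conj \<alpha>) * h x) (at x))"

definition inv_rel_escort ::
  "real set \<Rightarrow> (real \<Rightarrow> real) \<Rightarrow> real \<Rightarrow> (real \<Rightarrow> real) \<Rightarrow> real \<Rightarrow> real" where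
  "inv_rel_escort \<Omega> h \<alpha> g x =
     (let r = inv_scale \<alpha> g; y = inv_escort_coord \<Omega> h \<alpha> g
      in if x \<in> \<Omega> then (r * g (r * y x)) powr (1 / \<alpha>) * h x else 0)"

section \<open>Gaussian convolution\<close>

definition gauss :: "real \<Rightarrow> real \<Rightarrow> real" where
  "gauss \<tau> x = 1 / sqrt (2 * pi * \<tau>) * exp (- (x\<^sup>2) / (2 * \<tau>))"

lemma gauss_eq_normal_density: "0 < \<tau> \<Longrightarrow> gauss \<tau> = normal_density 0 (sqrt \<tau>)"
  by (auto simp: gauss_def normal_density_def fun_eq_iff)

definition gauss_conv :: "real \<Rightarrow> (real \<Rightarrow> real) \<Rightarrow> real \<Rightarrow> real" where
  "gauss_conv \<tau> g x = (LINT t|lborel. gauss \<tau> (x - t) * g t)"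

section \<open>The Fisher-Shannon complexity\<close>

text \<open>
  Local absolute continuity on the real line, in the form of the fundamental theorem of calculus
  for the Lebesgue integral. It entails that \<open>deriv g\<close> is the derivative of \<open>g\<close> almost everywhere;
  its arbitrary values on the remaining null set do not affect any integral.
\<close>

definition locally_abs_continuous :: "(real \<Rightarrow> real) \<Rightarrow> bool" where
  "locally_abs_continuous g \<longleftrightarrow> (\<forall>a b. a \<le> b \<longrightarrow>
     deriv g absolutely_integrable_on {a..b} \<and> integral {a..b} (deriv g) = g b - g a)"

text \<open>
  As usual, the Fisher information is infinite for densities that are not locally absolutely
  continuous on the whole line, for instance for those with a jump at an endpoint of their
  support (the uniform density is the simplest example). Where \<open>g\<close> vanishes, so does the
  integrand.
\<close>

definition fisher_integral :: "(real \<Rightarrow> real) \<Rightarrow> ennreal" where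
  "fisher_integral g =
     (if locally_abs_continuous g
      then \<integral>\<^sup>+x. ennreal (\<bar>deriv g x / g x\<bar>\<^sup>2 * g x) \<partial>lebesgue else \<top>)"

definition phi21 :: "(real \<Rightarrow> real) \<Rightarrow> ennreal" where
  "phi21 g = (if fisher_integral g = \<top> then \<top> else ennreal (sqrt (enn2real (fisher_integral g))))"

definition shannon_entropy :: "(real \<Rightarrow> real) \<Rightarrow> ereal" where
  "shannon_entropy g =
     enn2ereal (\<integral>\<^sup>+x. ennreal (- (g x * ln (g x))) \<partial>lborel)
     - enn2ereal (\<integral>\<^sup>+x. ennreal (g x * ln (g x)) \<partial>lborel)"

definition shannon_power :: "(real \<Rightarrow> real) \<Rightarrow> ennreal" where
  "shannon_power g = (case shannon_entropy g of
     ereal s \<Rightarrow> ennreal (exp s) | PInfty \<Rightarrow> \<top> | MInfty \<Rightarrow> 0)"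

text \<open>
  The complexity is infinite as soon as the Fisher information is. This is made explicit because
  \<open>\<top> * 0 = 0\<close> in \<^typ>\<open>ennreal\<close>, which would give a density with infinite Fisher information and
  entropy \<open>-\<infinity>\<close> the least possible complexity.
\<close>

definition fisher_shannon :: "(real \<Rightarrow> real) \<Rightarrow> ennreal" where
  "fisher_shannon g = (if phi21 g = \<top> then \<top> else phi21 g * shannon_power g)"

definition rel_fisher_shannon ::
  "real set \<Rightarrow> (real \<Rightarrow> real) \<Rightarrow> real \<Rightarrow> (real \<Rightarrow> real) \<Rightarrow> ennreal" where
  "rel_fisher_shannon \<Omega> h \<alpha> f = fisher_shannon (rel_escort \<Omega> h \<alpha> f)"

end

theory Submission
  imports Defs
begin

text \<open>
  Composing the inverse transformation with the transformation only rescales and translates a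
  density, and the Fisher-Shannon complexity is invariant under both operations. The claim is
  therefore that the complexity decreases under the heat flow, which is the concavity of the
  entropy power in dimension one. Let \<open>g\<close> have Fisher information \<open>I\<close> and let \<open>m\<close> be its
  convolution with a Gaussian \<open>G\<close> of variance \<open>\<tau>\<close>. Stam's inequality bounds the Fisher
  information of \<open>m\<close> by \<open>I / (1 + \<tau> I)\<close>. Dually, the entropy grows by at most
  \<open>ln (1 + \<tau> I) / 2\<close>: for fixed \<open>y\<close>, the monotone transport of the conditional density
  \<open>G (y - x) g x / m y\<close> to a Gaussian gives a logarithmic Sobolev inequality, which is then
  averaged over \<open>y\<close>. The two factors \<open>1 + \<tau> I\<close> cancel.
\<close>

section \<open>Primitives of integrable functions on the line\<close>

text \<open>By de Bruijn's identity the squared complexity is the time derivative of the squared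
  entropy power exp (2 h) along the heat flow, which is why its decrease amounts to concavity. The
  flow is never differentiated here: time \<tau> is compared directly with time 0, so a weak
  derivative is all the regularity of \<open>g\<close> that enters, and \<open>g\<close> may have
  zeros. Both bounds are equalities for a Gaussian of variance \<sigma>, where I = 1 / \<sigma>;
  this fixes the constants. The entropy bound rests on the chain rule. Let X have density
  \<open>g\<close>, let Z be an independent Gaussian of variance \<tau>, and Y = X + Z. The joint
  entropy is h(X) + h(Z) = h(Y) + h(X | Y), so an upper bound on h(Y) is a lower bound on h(X | Y).
  The conditional densities have mean Fisher information 1 / \<tau> + I, since the scores of X and Z
  are uncorrelated, and a density of Fisher information J has entropy at least ln (2 pi e / J) /
  2.\<close>

definition primitive :: "(real \<Rightarrow> real) \<Rightarrow> real \<Rightarrow> real" where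
  "primitive p x = (LINT t|lborel. indicator {..x} t * p t)"

lemma integrable_indicator_mult [intro]:
  fixes p :: "real \<Rightarrow> real"
  assumes "integrable lborel p" "A \<in> sets borel"
  shows "integrable lborel (\<lambda>t. indicator A t * p t)"
  using integrable_mult_indicator[of A lborel p] assms by simp

lemma primitive_diff:
  assumes p: "integrable lborel p" and "a \<le> b"
  shows "primitive p b - primitive p a = (LINT t|lborel. indicator {a..b} t * p t)"
proof -
  have "primitive p b - primitive p a
      = (LINT t|lborel. indicator {..b} t * p t - indicator {..a} t * p t)"
    unfolding primitive_def by (rule Bochner_Integration.integral_diff [symmetric]) (auto simp: p)
  also have "\<dots> = (LINT t|lborel. indicator {a..b} t * p t)"
  proof (rule integral_cong_AE)
    show "AE t in lborel. indicator {..b} t * p t - indicator {..a} t * p t = indicator {a..b} t * p t"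
      using AE_lborel_singleton[of a] by eventually_elim (use \<open>a \<le> b\<close> in \<open>auto simp: indicator_def\<close>)
  qed (use borel_measurable_integrable[OF p] in measurable)
  finally show ?thesis .
qed

lemma primitive_diff_integral:
  assumes p: "integrable lborel p" and "a \<le> b"
  shows "primitive p b - primitive p a = integral {a..b} p"
proof -
  have "set_integrable lborel {a..b} p"
    unfolding set_integrable_def using integrable_indicator_mult[OF p, of "{a..b}"] by simp
  from set_borel_integral_eq_integral(2)[OF this] show ?thesis
    using primitive_diff[OF assms] by (simp add: set_lebesgue_integral_def)
qed

lemma integrable_lborel_imp_integrable_on:
  fixes p :: "real \<Rightarrow> real"
  assumes p: "integrable lborel p"
  shows "p integrable_on {a..b}"
proof -
  have "set_integrable lborel {a..b} p"
    unfolding set_integrable_def using integrable_indicator_mult[OF p, of "{a..b}"] by simp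
  from set_borel_integral_eq_integral(1)[OF this] show ?thesis .
qed

lemma primitive_has_derivative:
  assumes p: "integrable lborel p" and c: "isCont p x"
  shows "(primitive p has_real_derivative p x) (at x)"
proof -
  have "((\<lambda>u. integral {x - 1..u} p) has_vector_derivative p x) (at x within {x - 1..x + 1})"
    using integral_has_vector_derivative_continuous_at[of p "x - 1" "x + 1" x "{}"]
      integrable_lborel_imp_integrable_on[OF p] c continuous_at_imp_continuous_within
    by force
  then have "((\<lambda>u. integral {x - 1..u} p) has_real_derivative p x) (at x)"
    by (simp add: has_real_derivative_iff_has_vector_derivative at_within_Icc_at)
  then have "((\<lambda>u. primitive p (x - 1) + integral {x - 1..u} p) has_real_derivative 0 + p x) (at x)"
    by (intro DERIV_add DERIV_const)
  moreover have "\<forall>\<^sub>F u in nhds x. primitive p (x - 1) + integral {x - 1..u} p = primitive p u"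
    using eventually_nhds_in_open[of "{x - 1<..}" x]
    by (auto elim!: eventually_mono simp: primitive_diff_integral[OF p, symmetric])
  ultimately show ?thesis
    by (simp add: DERIV_cong_ev)
qed

lemma primitive_at_top:
  assumes "integrable lborel p"
  shows "(primitive p \<longlongrightarrow> (LINT t|lborel. p t)) at_top"
  using tendsto_integral_at_top[of lborel p] assms unfolding primitive_def[abs_def] by simp

lemma primitive_at_bot:
  assumes p: "integrable lborel p"
  shows "(primitive p \<longlongrightarrow> 0) at_bot"
proof (rule tendsto_at_botI_sequentially)
  fix X :: "nat \<Rightarrow> real" assume X: "filterlim X at_bot sequentially"
  have "(\<lambda>n. LINT t|lborel. indicator {..X n} t * p t) \<longlonglongrightarrow> (LINT (t::real)|lborel. 0)"
  proof (rule integral_dominated_convergence)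
    show "integrable lborel (\<lambda>t. \<bar>p t\<bar>)" using p by simp
    show "AE t in lborel. (\<lambda>n. indicator {..X n} t * p t) \<longlonglongrightarrow> 0"
    proof (rule AE_I2)
      fix t
      have "\<forall>\<^sub>F n in sequentially. X n < t"
        using X by (simp add: filterlim_at_bot_dense)
      then have "\<forall>\<^sub>F n in sequentially. indicator {..X n} t * p t = 0"
        by eventually_elim auto
      then show "(\<lambda>n. indicator {..X n} t * p t) \<longlonglongrightarrow> 0"
        by (rule tendsto_eventually)
    qed
  qed (use borel_measurable_integrable[OF p] in \<open>auto simp: indicator_def\<close>)
  then show "(\<lambda>n. primitive p (X n)) \<longlonglongrightarrow> 0"
    by (simp add: primitive_def)
qed

lemma isCont_primitive:
  assumes p: "integrable lborel p"
  shows "isCont (primitive p) x"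
proof -
  have "continuous_on {x - 1..x + 1} (\<lambda>u. integral {x - 1..u} p)"
    by (rule indefinite_integral_continuous_1) (rule integrable_lborel_imp_integrable_on[OF p])
  then have "continuous_on {x - 1..x + 1} (\<lambda>u. primitive p (x - 1) + integral {x - 1..u} p)"
    by (intro continuous_intros)
  moreover have "primitive p (x - 1) + integral {x - 1..u} p = primitive p u" if "u \<in> {x - 1..x + 1}" for u
    using primitive_diff_integral[OF p, of "x - 1" u] that by simp
  ultimately have "continuous_on {x - 1..x + 1} (primitive p)"
    by (subst (asm) continuous_on_cong [OF refl]) auto
  then show ?thesis
    by (rule continuous_on_interior) simp
qed

lemma primitive_bounds:
  assumes p: "integrable lborel p" "\<And>x. 0 \<le> p x"
  shows "0 \<le> primitive p x" "primitive p x \<le> (LINT t|lborel. p t)"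
proof -
  show "0 \<le> primitive p x"
    unfolding primitive_def by (rule integral_nonneg_AE) (simp add: p)
  show "primitive p x \<le> (LINT t|lborel. p t)"
    unfolding primitive_def
  proof (rule integral_mono)
    show "indicator {..x} t * p t \<le> p t" for t
      using p by (auto simp: indicator_def)
  qed (auto simp: p)
qed

text \<open>Fubini replaces the pointwise product rule, since \<open>d\<close> is only a weak derivative of \<open>g\<close>.\<close>

lemma integral_by_parts_line:
  fixes g d u u' :: "real \<Rightarrow> real"
  assumes d: "integrable lborel d"
    and g: "\<And>a b. a \<le> b \<Longrightarrow> g b - g a = (LINT t|lborel. indicator {a..b} t * d t)"
    and u: "\<And>x. (u has_real_derivative u' x) (at x)" "continuous_on UNIV u'" "integrable lborel u'"
    and lim: "(u \<longlongrightarrow> 0) at_top" "(u \<longlongrightarrow> 0) at_bot"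
  shows "(LINT x|lborel. u' x * g x) = - (LINT x|lborel. u x * d x)"
proof -
  have [measurable]: "d \<in> borel_measurable borel" "u' \<in> borel_measurable borel"
    using borel_measurable_integrable[OF d] borel_measurable_integrable[OF u(3)] by simp_all
  have cu': "isCont u' x" for x
    using u(2) by (simp add: continuous_on_eq_continuous_at)
  \<comment> \<open>Two antiderivatives of \<open>u'\<close> differ by a constant, and both tend to
    0 at minus infinity.\<close>
  have uprim: "primitive u' x = u x" for x
  proof -
    have "\<exists>c. \<forall>x\<in>UNIV. primitive u' x - u x = c"
    proof (rule has_field_derivative_zero_constant)
      show "((\<lambda>x. primitive u' x - u x) has_real_derivative 0) (at x within UNIV)" for x
        using DERIV_diff[OF primitive_has_derivative[OF u(3) cu'] u(1)] by simp
    qed simp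
    then obtain c where c: "\<And>x. primitive u' x - u x = c" by auto
    have "((\<lambda>x. primitive u' x - u x) \<longlongrightarrow> 0 - 0) at_bot"
      by (intro tendsto_intros primitive_at_bot u lim)
    then have "c = 0" by (simp add: c tendsto_const_iff)
    with c[of x] show ?thesis by simp
  qed
  have int_u': "(LINT x|lborel. u' x) = 0"
  proof -
    have "(primitive u' \<longlongrightarrow> 0) at_top"
      using lim(1) uprim by presburger
    from tendsto_unique[OF _ primitive_at_top[OF u(3)] this] show ?thesis by simp
  qed
  define c where "c = g 0 - primitive d 0"
  have gc: "g x = c + primitive d x" for x
    using g[of 0 x] g[of x 0] primitive_diff[OF d, of 0 x] primitive_diff[OF d, of x 0]
    by (cases "0 \<le> x") (auto simp: c_def)
  interpret lborel_pair: pair_sigma_finite lborel lborel by unfold_locales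
  \<comment> \<open>Up to the constant \<open>c\<close>, \<open>g x\<close> is the integral of
    \<open>d s\<close> over s \<le> x. The constant drops out because \<open>u'\<close> has integral
    0, and exchanging the integrals leaves that of \<open>u'\<close> over x \<ge> s, which is
    \<open>- u s\<close>.\<close>
  let ?k = "\<lambda>x s. indicator {s..} x * u' x * d s :: real"
  have ks: "indicator {s..} x = (indicator {..x} s :: real)" for x s :: real
    by (simp add: indicator_def)
  have km: "case_prod ?k \<in> borel_measurable (lborel \<Otimes>\<^sub>M lborel)"
    unfolding ks by (simp add: indicator_def) measurable
  have ki: "integrable (lborel \<Otimes>\<^sub>M lborel) (case_prod ?k)"
  proof (rule Bochner_Integration.integrable_bound)
    show "integrable (lborel \<Otimes>\<^sub>M lborel) (\<lambda>(x, s). u' x * d s)"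
    proof (rule lborel_pair.Fubini_integrable)
      have "(\<lambda>x. LINT s|lborel. norm (case (x, s) of (x, s) \<Rightarrow> u' x * d s))
          = (\<lambda>x. \<bar>u' x\<bar> * (LINT s|lborel. \<bar>d s\<bar>))"
        by (simp add: abs_mult)
      then show "integrable lborel (\<lambda>x. LINT s|lborel. norm (case (x, s) of (x, s) \<Rightarrow> u' x * d s))"
        using u(3) by simp
    qed (use d in auto)
    show "AE x in lborel \<Otimes>\<^sub>M lborel. norm (case_prod ?k x) \<le> norm (case x of (x, s) \<Rightarrow> u' x * d s)"
      by (rule AE_I2) (auto simp: indicator_def)
  qed (rule km)
  have "(LINT x|lborel. u' x * g x) = (LINT x|lborel. c * u' x + u' x * primitive d x)"
    by (simp add: gc algebra_simps)
  also have "\<dots> = (LINT x|lborel. c * u' x) + (LINT x|lborel. u' x * primitive d x)"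
  proof (rule Bochner_Integration.integral_add)
    have "u' x * primitive d x = (LINT s|lborel. ?k x s)" for x
      unfolding primitive_def ks
      by (subst Bochner_Integration.integral_mult_right_zero [symmetric])
        (simp add: mult_ac)
    then show "integrable lborel (\<lambda>x. u' x * primitive d x)"
      using lborel_pair.integrable_fst[OF ki] by simp
  qed (use u in auto)
  also have "(LINT x|lborel. c * u' x) = 0" using int_u' by simp
  also have "(LINT x|lborel. u' x * primitive d x) = (LINT x|lborel. (LINT s|lborel. ?k x s))"
    unfolding primitive_def ks
    by (subst Bochner_Integration.integral_mult_right_zero [symmetric]) (simp add: mult_ac)
  also have "\<dots> = (LINT s|lborel. (LINT x|lborel. ?k x s))"
    by (rule lborel_pair.Fubini_integral [OF ki, symmetric])
  also have "\<dots> = (LINT s|lborel. - (u s * d s))"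
  proof (rule Bochner_Integration.integral_cong)
    fix s
    have "(LINT x|lborel. indicator {s..} x * u' x) = (LINT x|lborel. u' x) - primitive u' s"
    proof -
      have "(LINT x|lborel. indicator {s..} x * u' x) = (LINT x|lborel. u' x - indicator {..s} x * u' x)"
      proof (rule integral_cong_AE)
        show "AE x in lborel. indicator {s..} x * u' x = u' x - indicator {..s} x * u' x"
          using AE_lborel_singleton[of s] by eventually_elim (auto simp: indicator_def)
      qed measurable
      also have "\<dots> = (LINT x|lborel. u' x) - primitive u' s"
        unfolding primitive_def by (rule Bochner_Integration.integral_diff) (auto simp: u)
      finally show ?thesis .
    qed
    then show "(LINT x|lborel. ?k x s) = - (u s * d s)"
      by (simp add: int_u' uprim)
  qed simp
  finally show ?thesis by simp
qed

section \<open>Quantile functions\<close>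

text \<open>Stated for every \<open>pdf\<close>, not only for positive ones, because it is also
  applied to \<open>h\<close>, which vanishes off the closure of \<Omega>.\<close>

lemma quantile_exists:
  assumes p: "pdf p" and v: "0 < v" "v < 1"
  shows "\<exists>x. primitive p x = v"
proof -
  have pi: "integrable lborel p" "(LINT t|lborel. p t) = 1"
    using p by (auto simp: pdf_def has_bochner_integral_iff)
  have "\<forall>\<^sub>F x in at_bot. primitive p x < v"
    using order_tendstoD(2)[OF primitive_at_bot[OF pi(1)] v(1)] .
  then obtain a where a: "\<And>x. x \<le> a \<Longrightarrow> primitive p x < v"
    by (auto simp: eventually_at_bot_linorder)
  have "\<forall>\<^sub>F x in at_top. v < primitive p x"
    using order_tendstoD(1)[OF primitive_at_top[OF pi(1)], of v] v(2) pi(2) by simp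
  then obtain b where b: "\<And>x. b \<le> x \<Longrightarrow> v < primitive p x"
    by (auto simp: eventually_at_top_linorder)
  have "a \<le> b" using a[of b] b[of b] by force
  then have "\<exists>x\<ge>a. x \<le> b \<and> primitive p x = v"
    using a[of a] b[of b] by (intro IVT) (auto intro: isCont_primitive pi less_imp_le)
  then show ?thesis by blast
qed

locale positive_density =
  fixes p :: "real \<Rightarrow> real"
  assumes pdf: "pdf p" and pos: "\<And>x. 0 < p x" and cont: "continuous_on UNIV p"
begin

lemma integrable: "integrable lborel p" and total: "(LINT t|lborel. p t) = 1"
  using pdf by (auto simp: pdf_def has_bochner_integral_iff)

lemma isCont_p: "isCont p x"
  using cont by (simp add: continuous_on_eq_continuous_at)

lemma deriv_primitive: "(primitive p has_real_derivative p x) (at x)"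
  by (intro primitive_has_derivative integrable isCont_p)

lemma strict_mono_primitive: "strict_mono (primitive p)"
proof (rule strict_monoI)
  fix a b :: real assume "a < b"
  moreover have "\<exists>y. (primitive p has_real_derivative y) (at x) \<and> 0 < y" for x
    using deriv_primitive[of x] pos[of x] by blast
  ultimately show "primitive p a < primitive p b"
    by (rule DERIV_pos_imp_increasing)
qed

lemma primitive_in: "0 < primitive p x" "primitive p x < 1"
proof -
  have "primitive p (x - 1) < primitive p x" "primitive p x < primitive p (x + 1)"
    using strict_mono_primitive by (auto simp: strict_mono_def)
  moreover have "0 \<le> primitive p (x - 1)" "primitive p (x + 1) \<le> 1"
    using primitive_bounds[OF integrable] pos total by (auto simp: less_imp_le)
  ultimately show "0 < primitive p x" "primitive p x < 1" by auto
qed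

text \<open>The distribution function takes its values strictly between 0 and 1; for all other
  \<open>v\<close> the choice is arbitrary.\<close>

definition quantile :: "real \<Rightarrow> real" where
  "quantile v = (SOME x. primitive p x = v)"

lemma primitive_quantile: "0 < v \<Longrightarrow> v < 1 \<Longrightarrow> primitive p (quantile v) = v"
  unfolding quantile_def using someI_ex[OF quantile_exists[OF pdf]] .

lemma quantile_primitive: "quantile (primitive p x) = x"
  using primitive_quantile[OF primitive_in] strict_mono_eq[OF strict_mono_primitive] by simp

lemma quantile_mono: "0 < v \<Longrightarrow> v \<le> w \<Longrightarrow> w < 1 \<Longrightarrow> quantile v \<le> quantile w"
  using strict_mono_less_eq[OF strict_mono_primitive, of "quantile v" "quantile w"]
  by (simp add: primitive_quantile)

lemma quantile_deriv:
  assumes v: "0 < v" "v < 1"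
  shows "(quantile has_real_derivative inverse (p (quantile v))) (at v)"
proof (rule DERIV_inverse_function)
  show "(primitive p has_real_derivative p (quantile v)) (at (quantile v))"
    by (rule deriv_primitive)
  have "isCont quantile (primitive p (quantile v))"
    by (rule isCont_inverse_function[of 1])
       (auto simp: quantile_primitive isCont_primitive integrable)
  then show "isCont quantile v" by (simp add: primitive_quantile v)
qed (use pos[of "quantile v"] v in \<open>auto simp: primitive_quantile\<close>)

end

section \<open>The Gaussian kernel\<close>

context
  fixes \<tau> :: real
  assumes \<tau>: "0 < \<tau>"
begin

lemma gauss_pos: "0 < gauss \<tau> x"
  using \<tau> by (simp add: gauss_def)

lemma gauss_measurable [measurable]: "gauss \<tau> \<in> borel_measurable borel"
  by (simp add: gauss_eq_normal_density[OF \<tau>])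

lemma continuous_gauss: "continuous_on S (gauss \<tau>)"
  unfolding gauss_def[abs_def] by (intro continuous_intros) (use \<tau> in auto)

lemma gauss_deriv: "(gauss \<tau> has_real_derivative - (x / \<tau>) * gauss \<tau> x) (at x)"
  unfolding gauss_def[abs_def] using \<tau>
  by (auto intro!: derivative_eq_intros simp: field_simps)

lemma ln_gauss: "ln (gauss \<tau> x) = - ln (2 * pi * \<tau>) / 2 - x\<^sup>2 / (2 * \<tau>)"
  unfolding gauss_def using \<tau> by (simp add: ln_mult ln_div ln_sqrt field_simps)

lemma gauss_le: "gauss \<tau> x \<le> gauss \<tau> 0"
  unfolding gauss_def using \<tau> by (intro mult_left_mono) auto

text \<open>This is t exp (-t) \<le> 1 at t = x^2 / (2 \<tau>). Since the Gaussian times 1, x or x^2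
  is bounded, it can be integrated against any integrable function, so the densities may have
  infinite moments.\<close>

lemma square_gauss_le: "x\<^sup>2 * gauss \<tau> x \<le> 2 * \<tau> * gauss \<tau> 0"
proof -
  have "x\<^sup>2 / (2 * \<tau>) \<le> exp (x\<^sup>2 / (2 * \<tau>))"
    using exp_ge_add_one_self[of "x\<^sup>2 / (2 * \<tau>)"] by linarith
  then have "x\<^sup>2 / (2 * \<tau>) * exp (- (x\<^sup>2 / (2 * \<tau>)))
      \<le> exp (x\<^sup>2 / (2 * \<tau>)) * exp (- (x\<^sup>2 / (2 * \<tau>)))"
    by (rule mult_right_mono) simp
  then have "x\<^sup>2 / (2 * \<tau>) * exp (- (x\<^sup>2 / (2 * \<tau>))) \<le> 1"
    by (simp add: mult_exp_exp)
  then have "x\<^sup>2 * exp (- (x\<^sup>2) / (2 * \<tau>)) \<le> 2 * \<tau>"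
    using \<tau> by (simp add: field_simps)
  then have "1 / sqrt (2 * pi * \<tau>) * (x\<^sup>2 * exp (- (x\<^sup>2) / (2 * \<tau>))) \<le> 1 / sqrt (2 * pi * \<tau>) * (2 * \<tau>)"
    by (rule mult_left_mono) (use \<tau> in simp)
  then show ?thesis
    by (simp add: gauss_def mult_ac)
qed

lemma abs_gauss_le: "\<bar>x\<bar> * gauss \<tau> x \<le> (1 + 2 * \<tau>) * gauss \<tau> 0"
proof -
  have "\<bar>x\<bar> \<le> 1 + x\<^sup>2"
  proof (cases "\<bar>x\<bar> \<le> 1")
    case False
    then show ?thesis
      using self_le_power[of "\<bar>x\<bar>" 2] by simp
  qed (simp add: add_increasing2)
  then have "\<bar>x\<bar> * gauss \<tau> x \<le> (1 + x\<^sup>2) * gauss \<tau> x"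
    by (rule mult_right_mono) (use gauss_pos[of x] in simp)
  also have "\<dots> \<le> (1 + 2 * \<tau>) * gauss \<tau> 0"
    using gauss_le[of x] square_gauss_le[of x] by (simp add: algebra_simps)
  finally show ?thesis .
qed

lemma gauss_integral: "integrable lborel (gauss \<tau>)" "(LINT x|lborel. gauss \<tau> x) = 1"
  using \<tau> by (simp_all add: gauss_eq_normal_density)

lemma gauss_first_moment:
  "integrable lborel (\<lambda>x. x * gauss \<tau> x)" "(LINT x|lborel. x * gauss \<tau> x) = 0"
  using normal_moment_nz_1[of "sqrt \<tau>" 0] \<tau>
  by (simp_all add: gauss_eq_normal_density has_bochner_integral_iff mult.commute)

lemma gauss_second_moment:
  "integrable lborel (\<lambda>x. x\<^sup>2 * gauss \<tau> x)" "(LINT x|lborel. x\<^sup>2 * gauss \<tau> x) = \<tau>"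
  using normal_moment_even[of "sqrt \<tau>" 0 1] \<tau>
  by (simp_all add: gauss_eq_normal_density has_bochner_integral_iff mult.commute numeral_2_eq_2)

lemma gauss_tendsto: "(gauss \<tau> \<longlongrightarrow> 0) at_top" "(gauss \<tau> \<longlongrightarrow> 0) at_bot"
proof -
  have "((\<lambda>x. 1 / sqrt (2 * pi * \<tau>) * exp (- (x\<^sup>2) / (2 * \<tau>))) \<longlongrightarrow> 1 / sqrt (2 * pi * \<tau>) * 0) F"
    if "filterlim (\<lambda>x::real. x\<^sup>2) at_top F" for F
  proof (intro tendsto_mult tendsto_const filterlim_compose[OF exp_at_bot])
    show "filterlim (\<lambda>x. - (x\<^sup>2) / (2 * \<tau>)) at_bot F"
      using filterlim_tendsto_pos_mult_at_top[OF tendsto_const _ that, of "1 / (2 * \<tau>)"] \<tau>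
      by (simp add: filterlim_uminus_at_bot)
  qed
  then show "(gauss \<tau> \<longlongrightarrow> 0) at_top" "(gauss \<tau> \<longlongrightarrow> 0) at_bot"
    unfolding gauss_def[abs_def]
    by (simp_all add: filterlim_pow_at_top filterlim_ident filterlim_pow_at_bot_even)
qed

lemma pdf_gauss: "pdf (gauss \<tau>)"
  using gauss_integral gauss_pos by (simp add: pdf_def has_bochner_integral_iff less_imp_le)

lemma positive_density_gauss: "positive_density (gauss \<tau>)"
  by unfold_locales (auto intro: pdf_gauss gauss_pos continuous_gauss)

end

section \<open>Convolution\<close>

text \<open>\<open>gauss_conv\<close> is the case k = \<open>gauss\<close> \<tau>. The kernel is
  kept general because the Gaussian times z or z^2, and its derivative, are convolved as
  well.\<close>

definition conv :: "(real \<Rightarrow> real) \<Rightarrow> (real \<Rightarrow> real) \<Rightarrow> real \<Rightarrow> real" where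
  "conv k w y = (LINT x|lborel. k (y - x) * w x)"

lemma integrable_bounded_mult:
  fixes k w :: "real \<Rightarrow> real"
  assumes [measurable]: "k \<in> borel_measurable borel" and K: "\<And>x. \<bar>k x\<bar> \<le> K"
    and w: "integrable lborel w"
  shows "integrable lborel (\<lambda>x. k x * w x)"
proof (rule Bochner_Integration.integrable_bound)
  show "integrable lborel (\<lambda>x. K * w x)" using w by simp
  have "\<bar>k x\<bar> * \<bar>w x\<bar> \<le> \<bar>K\<bar> * \<bar>w x\<bar>" for x
    by (rule mult_right_mono) (use K[of x] in auto)
  then show "AE x in lborel. norm (k x * w x) \<le> norm (K * w x)"
    by (simp add: abs_mult)
qed (use borel_measurable_integrable[OF w] in measurable)

lemma integrable_conv_integrand:
  fixes k w :: "real \<Rightarrow> real"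
  assumes [measurable]: "k \<in> borel_measurable borel" and K: "\<And>x. \<bar>k x\<bar> \<le> K"
    and w: "integrable lborel w"
  shows "integrable lborel (\<lambda>x. k (y - x) * w x)"
  by (rule integrable_bounded_mult[OF _ _ w]) (use K in auto)

text \<open>Fubini and translation invariance. All averages over \<open>y\<close> below are computed
  with it, so that only the moments of the Gaussian remain to be inserted.\<close>

lemma has_bochner_integral_conv:
  assumes k: "integrable lborel k" and w: "integrable lborel w"
  shows "has_bochner_integral lborel (conv k w) ((LINT x|lborel. k x) * (LINT x|lborel. w x))"
proof -
  have [measurable]: "k \<in> borel_measurable borel" "w \<in> borel_measurable borel"
    using k w by (auto dest: borel_measurable_integrable)
  interpret lborel_pair: pair_sigma_finite lborel lborel by unfold_locales
  let ?f = "\<lambda>x y. k (y - x) * w x"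
  have shift: "integrable lborel (\<lambda>y. k (y - x))" "(LINT y|lborel. k (y - x)) = (LINT y|lborel. k y)"
    "(LINT y|lborel. \<bar>k (y - x)\<bar>) = (LINT y|lborel. \<bar>k y\<bar>)" for x
    using lborel_integrable_real_affine[OF k, of 1 "- x"] lborel_integral_real_affine[of 1 k "- x"]
      lborel_integral_real_affine[of 1 "\<lambda>y. \<bar>k y\<bar>" "- x"]
    by simp_all
  have f: "integrable (lborel \<Otimes>\<^sub>M lborel) (case_prod ?f)"
  proof (rule lborel_pair.Fubini_integrable)
    show "integrable lborel (\<lambda>x. LINT y|lborel. norm (case (x, y) of (x, y) \<Rightarrow> ?f x y))"
      using w by (simp add: abs_mult shift)
  qed (auto simp: shift)
  have "integrable lborel (conv k w)"
    using lborel_pair.integrable_snd[OF f] by (simp add: conv_def[abs_def])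
  moreover have "(LINT y|lborel. conv k w y) = (LINT x|lborel. k x) * (LINT x|lborel. w x)"
    using lborel_pair.Fubini_integral[OF f] by (simp add: conv_def shift)
  ultimately show ?thesis by (simp add: has_bochner_integral_iff)
qed

lemma isCont_conv:
  assumes k: "continuous_on UNIV k" "\<And>x. \<bar>k x\<bar> \<le> K" and w: "integrable lborel w"
  shows "isCont (conv k w) y"
  unfolding continuous_at_sequentially conv_def comp_def
proof (intro allI impI)
  fix X :: "nat \<Rightarrow> real" assume X: "X \<longlonglongrightarrow> y"
  have [measurable]: "k \<in> borel_measurable borel" "w \<in> borel_measurable borel"
    using k w by (auto dest: borel_measurable_integrable intro: borel_measurable_continuous_onI)
  show "(\<lambda>n. LINT x|lborel. k (X n - x) * w x) \<longlonglongrightarrow> (LINT x|lborel. k (y - x) * w x)"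
  proof (rule integral_dominated_convergence)
    show "integrable lborel (\<lambda>x. K * \<bar>w x\<bar>)" using w by simp
    show "AE x in lborel. (\<lambda>n. k (X n - x) * w x) \<longlonglongrightarrow> k (y - x) * w x"
      by (intro AE_I2 tendsto_intros continuous_on_tendsto_compose[OF k(1)] X) auto
    show "AE x in lborel. norm (k (X n - x) * w x) \<le> K * \<bar>w x\<bar>" for n
      by (intro AE_I2) (simp add: abs_mult mult_right_mono k)
  qed auto
qed

lemma conv_has_derivative:
  assumes k: "\<And>x. (k has_real_derivative k' x) (at x)" "continuous_on UNIV k'"
    and K: "\<And>x. \<bar>k x\<bar> \<le> K" "\<And>x. \<bar>k' x\<bar> \<le> K'" and w: "integrable lborel w"
  shows "(conv k w has_real_derivative conv k' w y) (at y)"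
proof -
  have ck: "continuous_on UNIV k"
    using k(1) by (meson DERIV_continuous_on UNIV_I has_field_derivative_at_within)
  have [measurable]: "k \<in> borel_measurable borel" "k' \<in> borel_measurable borel" "w \<in> borel_measurable borel"
    using k ck w by (auto dest: borel_measurable_integrable intro: borel_measurable_continuous_onI)
  \<comment> \<open>The mean value theorem supplies the dominating function
    \<open>K' * \<bar>w x\<bar>\<close> for the difference quotients.\<close>
  have lip: "\<bar>k b - k a\<bar> \<le> K' * \<bar>b - a\<bar>" for a b
    using field_differentiable_bound[of UNIV k k' K' b a] k(1) K(2) by simp
  show ?thesis
    unfolding DERIV_def tendsto_at_iff_sequentially comp_def
  proof (intro allI impI)
    fix X :: "nat \<Rightarrow> real" assume X0: "\<forall>i. X i \<in> UNIV - {0}" and X: "X \<longlonglongrightarrow> 0"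
    have "(\<lambda>n. LINT x|lborel. (k (y + X n - x) - k (y - x)) / X n * w x) \<longlonglongrightarrow> conv k' w y"
      unfolding conv_def
    proof (rule integral_dominated_convergence)
      show "integrable lborel (\<lambda>x. K' * \<bar>w x\<bar>)" using w by simp
      show "AE x in lborel. (\<lambda>n. (k (y + X n - x) - k (y - x)) / X n * w x) \<longlonglongrightarrow> k' (y - x) * w x"
      proof (intro AE_I2 tendsto_mult tendsto_const)
        fix x
        show "(\<lambda>n. (k (y + X n - x) - k (y - x)) / X n) \<longlonglongrightarrow> k' (y - x)"
          using k(1)[of "y - x"] X X0
          unfolding DERIV_def tendsto_at_iff_sequentially comp_def
          by (auto simp: add_diff_eq add_diff_add diff_add_eq)
      qed
      show "AE x in lborel. norm ((k (y + X n - x) - k (y - x)) / X n * w x) \<le> K' * \<bar>w x\<bar>" for n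
      proof (intro AE_I2)
        fix x
        have "\<bar>(k (y + X n - x) - k (y - x)) / X n\<bar> \<le> K'"
          using lip[of "y + X n - x" "y - x"] X0 by (simp add: field_simps)
        then show "norm ((k (y + X n - x) - k (y - x)) / X n * w x) \<le> K' * \<bar>w x\<bar>"
          unfolding real_norm_def abs_mult by (rule mult_right_mono) simp
      qed
    qed auto
    moreover have "(LINT x|lborel. (k (y + X n - x) - k (y - x)) / X n * w x)
        = (conv k w (y + X n) - conv k w y) / X n" for n
    proof -
      have "(LINT x|lborel. (k (y + X n - x) - k (y - x)) / X n * w x)
          = (LINT x|lborel. (k (y + X n - x) * w x - k (y - x) * w x) / X n)"
        by (simp add: algebra_simps)
      also have "\<dots> = (conv k w (y + X n) - conv k w y) / X n"
        unfolding conv_def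
        by (subst Bochner_Integration.integral_diff [symmetric])
          (auto intro!: integrable_conv_integrand[OF _ K(1) w])
      finally show ?thesis .
    qed
    ultimately show "(\<lambda>n. (conv k w (y + X n) - conv k w y) / X n) \<longlonglongrightarrow> conv k' w y"
      by (simp only:)
  qed
qed

section \<open>Densities of finite Fisher information under the heat flow\<close>

lemma has_bochner_integral_mono:
  fixes f g :: "'a \<Rightarrow> real"
  assumes "has_bochner_integral M f a" "has_bochner_integral M g b" "\<And>x. f x \<le> g x"
  shows "a \<le> b"
  using assms by (auto simp: has_bochner_integral_iff intro: integral_mono)

text \<open>
  In this inequality \<open>q = G * g\<close>, \<open>G * s\<close> plays the role of \<open>q'\<close>, and \<open>T'\<close> is the derivative of a
  transport map \<open>T\<close> from \<open>q / m\<close> to a centred Gaussian of variance \<open>a\<close>.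
\<close>

lemma transport_pointwise:
  fixes G g m a \<kappa> s T T' q :: real
  assumes pos: "0 < G" "0 \<le> g" "0 < m" "0 < a" "0 < \<kappa>" and s: "g = 0 \<Longrightarrow> s = 0"
    and q: "q = G * g" and T': "T' = \<kappa> * (q / m) / gauss a T"
  shows "q * ln q - q * ln m
    \<le> (- ln (2 * pi * a) / 2 - 1 - ln \<kappa>) * q + (T' * q + T * (G * s)) + a / 2 * (G * (s\<^sup>2 / g))"
proof (cases "g = 0")
  case True
  then show ?thesis using q s by simp
next
  case False
  then have g: "0 < g" and qp: "0 < q" using pos q by auto
  have ga: "0 < gauss a T" using gauss_pos pos by simp
  have T'p: "0 < T'" using T' pos qp ga by simp
  have "ln T' = ln \<kappa> + ln q - ln m - ln (gauss a T)"
    using T' pos qp ga by (simp add: ln_mult ln_div)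
  \<comment> \<open>The equation above is the transport equation in logarithmic form. Linearising
    its left-hand side leaves \<open>T'\<close> itself, which can later be integrated by
    parts.\<close>
  moreover have "ln T' \<le> T' - 1" using T'p by (rule ln_le_minus_one)
  ultimately have "ln q - ln m \<le> T' - 1 - ln \<kappa> - T\<^sup>2 / (2 * a) - ln (2 * pi * a) / 2"
    by (simp add: ln_gauss pos)
  then have "q * (ln q - ln m) \<le> q * (T' - 1 - ln \<kappa> - T\<^sup>2 / (2 * a) - ln (2 * pi * a) / 2)"
    by (rule mult_left_mono) (use qp in simp)
  \<comment> \<open>The quadratic term of the Gaussian target absorbs the cross term in
    \<open>T\<close>: together with the Fisher term they form a perfect square.\<close>
  moreover have "0 \<le> T\<^sup>2 / (2 * a) * q + T * (G * s) + a / 2 * (G * (s\<^sup>2 / g))"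
  proof -
    have "T\<^sup>2 / (2 * a) * q + T * (G * s) + a / 2 * (G * (s\<^sup>2 / g)) = G / (2 * a * g) * (T * g + a * s)\<^sup>2"
      using g pos by (simp add: q power2_eq_square field_simps)
    then show ?thesis using g pos by simp
  qed
  ultimately show ?thesis by (simp add: algebra_simps)
qed

text \<open>\<open>d\<close> is a Borel version of the weak derivative. With \<open>d_zero\<close>,
  d = (d / g) g holds even at the zeros of \<open>g\<close>, where division yields 0, so the algebra
  of scores is valid everywhere.\<close>

locale fisher_density =
  fixes g d :: "real \<Rightarrow> real" and \<tau> :: real
  assumes \<tau>: "0 < \<tau>"
    and nonneg: "\<And>x. 0 \<le> g x"
    and g_int: "integrable lborel g" and g_total: "(LINT x|lborel. g x) = 1"
    and d_meas [measurable]: "d \<in> borel_measurable borel"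
    and d_zero: "\<And>x. g x = 0 \<Longrightarrow> d x = 0"
    and fisher_int: "integrable lborel (\<lambda>x. (d x)\<^sup>2 / g x)"
    and weak_deriv: "\<And>a b. a \<le> b \<Longrightarrow> g b - g a = (LINT t|lborel. indicator {a..b} t * d t)"
begin

definition fisher :: real where "fisher = (LINT x|lborel. (d x)\<^sup>2 / g x)"

section \<open>Regularity forced by finite Fisher information\<close>

lemma g_meas [measurable]: "g \<in> borel_measurable borel"
  using borel_measurable_integrable[OF g_int] by simp

text \<open>By the inequality of the arithmetic and geometric means, |d| \<le> d^2 / g + g. Mass and
  Fisher information thus control the total variation, which makes \<open>g\<close> bounded and
  continuous.\<close>

lemma d_int: "integrable lborel d"
proof (rule Bochner_Integration.integrable_bound)
  show "integrable lborel (\<lambda>x. (d x)\<^sup>2 / g x + g x)"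
    using fisher_int g_int by simp
  have "\<bar>d x\<bar> \<le> (d x)\<^sup>2 / g x + g x" for x
  proof (cases "g x = 0")
    case False
    then have g: "0 < g x" using nonneg[of x] by simp
    have "\<bar>d x\<bar> * g x \<le> (d x)\<^sup>2 + g x * g x"
    proof -
      have "0 \<le> \<bar>d x\<bar> * g x" using g by simp
      then show ?thesis
        using sum_squares_bound[of "\<bar>d x\<bar>" "g x"] by (simp add: power2_eq_square)
    qed
    then show ?thesis using g by (simp add: field_simps)
  qed (simp add: d_zero)
  moreover have "0 \<le> (d x)\<^sup>2 / g x + g x" for x using nonneg by simp
  ultimately show "AE x in lborel. norm (d x) \<le> norm ((d x)\<^sup>2 / g x + g x)"
    by simp
qed simp

lemma g_eq_primitive: "g x = (g 0 - primitive d 0) + primitive d x"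
  using weak_deriv[of 0 x] weak_deriv[of x 0] primitive_diff[OF d_int, of 0 x]
    primitive_diff[OF d_int, of x 0]
  by (cases "0 \<le> x") auto

lemma isCont_g: "isCont g x"
proof -
  have "isCont (\<lambda>x. (g 0 - primitive d 0) + primitive d x) x"
    by (intro continuous_intros isCont_primitive d_int)
  then show ?thesis by (simp add: g_eq_primitive [symmetric])
qed

lemma g_bounded: "\<exists>M. \<forall>x. g x \<le> M"
proof -
  have "\<bar>primitive d x\<bar> \<le> (LINT t|lborel. \<bar>d t\<bar>)" for x
  proof -
    have "\<bar>primitive d x\<bar> \<le> (LINT t|lborel. \<bar>indicator {..x} t * d t\<bar>)"
      unfolding primitive_def by (rule integral_abs_bound)
    also have "\<dots> \<le> (LINT t|lborel. \<bar>d t\<bar>)"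
    proof (rule integral_mono)
      show "integrable lborel (\<lambda>t. \<bar>indicator {..x} t * d t\<bar>)"
        using integrable_abs[OF integrable_indicator_mult[OF d_int, of "{..x}"]] by simp
      show "\<bar>indicator {..x} t * d t\<bar> \<le> \<bar>d t\<bar>" for t
        by (simp add: indicator_def)
    qed (use d_int in auto)
    finally show ?thesis .
  qed
  then have "g x \<le> g 0 - primitive d 0 + (LINT t|lborel. \<bar>d t\<bar>)" for x
    using g_eq_primitive[of x] by (smt (verit))
  then show ?thesis by blast
qed

lemma gauss_mult_integrable [intro]:
  assumes w: "integrable lborel w"
  shows "integrable lborel (\<lambda>x. gauss \<tau> (y - x) * w x)"
    and "integrable lborel (\<lambda>x. (y - x) * gauss \<tau> (y - x) * w x)"
    and "integrable lborel (\<lambda>x. (y - x)\<^sup>2 * gauss \<tau> (y - x) * w x)"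
proof -
  note [measurable] = gauss_measurable[OF \<tau>]
  have a: "\<bar>gauss \<tau> z\<bar> = gauss \<tau> z" for z
    using gauss_pos[OF \<tau>, of z] by simp
  show "integrable lborel (\<lambda>x. gauss \<tau> (y - x) * w x)"
    by (rule integrable_conv_integrand[OF _ _ w, of _ "gauss \<tau> 0"]) (use gauss_le[OF \<tau>] a in simp_all)
  show "integrable lborel (\<lambda>x. (y - x) * gauss \<tau> (y - x) * w x)"
    by (rule integrable_conv_integrand[OF _ _ w, of "\<lambda>z. z * gauss \<tau> z" "(1 + 2 * \<tau>) * gauss \<tau> 0"])
      (use abs_gauss_le[OF \<tau>] a in \<open>simp_all add: abs_mult\<close>)
  show "integrable lborel (\<lambda>x. (y - x)\<^sup>2 * gauss \<tau> (y - x) * w x)"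
    by (rule integrable_conv_integrand[OF _ _ w, of "\<lambda>z. z\<^sup>2 * gauss \<tau> z" "2 * \<tau> * gauss \<tau> 0"])
      (use square_gauss_le[OF \<tau>] a in \<open>simp_all add: abs_mult\<close>)
qed

section \<open>The convolved density, its score and Stam's inequality\<close>

abbreviation m :: "real \<Rightarrow> real" where "m \<equiv> conv (gauss \<tau>) g"

lemma gauss_mult_g_nonneg: "0 \<le> gauss \<tau> (y - x) * g x"
  using nonneg gauss_pos[OF \<tau>, of "y - x"] by simp

lemma m_pos: "0 < m y"
proof -
  have "m y \<noteq> 0"
  proof
    assume "m y = 0"
    then have "AE x in lborel. gauss \<tau> (y - x) * g x = 0"
      unfolding conv_def
      by (subst (asm) integral_nonneg_eq_0_iff_AE)
        (auto intro!: gauss_mult_integrable g_int simp: gauss_mult_g_nonneg)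
    then have "AE x in lborel. g x = 0"
      by eventually_elim (use gauss_pos[OF \<tau>] in \<open>auto simp: less_le\<close>)
    then have "(LINT x|lborel. g x) = (LINT (x::real)|lborel. 0)"
      by (intro integral_cong_AE) auto
    then show False using g_total by simp
  qed
  moreover have "0 \<le> m y"
    unfolding conv_def
    by (rule integral_nonneg_AE) (simp add: gauss_mult_g_nonneg)
  ultimately show ?thesis by simp
qed

lemma m_le: "m y \<le> gauss \<tau> 0"
proof -
  have "m y \<le> (LINT x|lborel. gauss \<tau> 0 * g x)"
    unfolding conv_def
    by (rule integral_mono)
      (auto intro: gauss_mult_integrable g_int mult_right_mono nonneg gauss_le \<tau>)
  then show ?thesis by (simp add: g_total)
qed

lemma has_bochner_integral_m: "has_bochner_integral lborel m 1"
  using has_bochner_integral_conv[OF gauss_integral(1)[OF \<tau>] g_int]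
  by (simp add: gauss_integral \<tau> g_total)

lemma square_div_g:
  "(\<beta> * ((y - x) / \<tau> * g x) + \<mu> * d x)\<^sup>2 / g x
    = \<beta>\<^sup>2 / \<tau>\<^sup>2 * ((y - x)\<^sup>2 * g x) + 2 * \<beta> * \<mu> / \<tau> * ((y - x) * d x) + \<mu>\<^sup>2 * ((d x)\<^sup>2 / g x)"
  using \<tau> d_zero[of x] by (cases "g x = 0") (simp_all add: power2_eq_square field_simps)

text \<open>Used twice: \<mu> = \<beta> - 1 gives Stam's inequality, and \<beta> = \<mu> = 1 the
  Fisher information of the conditional densities. The cross term disappears on averaging over
  \<open>y\<close> because the Gaussian is centred.\<close>

lemma quadratic_kernel:
  shows "integrable lborel (\<lambda>x. gauss \<tau> (y - x) * ((\<beta> * ((y - x) / \<tau> * g x) + \<mu> * d x)\<^sup>2 / g x))"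
    and "has_bochner_integral lborel
      (\<lambda>y. LINT x|lborel. gauss \<tau> (y - x) * ((\<beta> * ((y - x) / \<tau> * g x) + \<mu> * d x)\<^sup>2 / g x))
      (\<beta>\<^sup>2 / \<tau> + \<mu>\<^sup>2 * fisher)"
proof -
  have eq: "gauss \<tau> (y - x) * ((\<beta> * ((y - x) / \<tau> * g x) + \<mu> * d x)\<^sup>2 / g x)
    = \<beta>\<^sup>2 / \<tau>\<^sup>2 * ((y - x)\<^sup>2 * gauss \<tau> (y - x) * g x)
      + 2 * \<beta> * \<mu> / \<tau> * ((y - x) * gauss \<tau> (y - x) * d x)
      + \<mu>\<^sup>2 * (gauss \<tau> (y - x) * ((d x)\<^sup>2 / g x))" for x y
    unfolding square_div_g by (simp add: algebra_simps add_divide_distrib diff_divide_distrib)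
  note int = gauss_mult_integrable(3)[OF g_int] gauss_mult_integrable(2)[OF d_int]
    gauss_mult_integrable(1)[OF fisher_int]
  show "integrable lborel (\<lambda>x. gauss \<tau> (y - x) * ((\<beta> * ((y - x) / \<tau> * g x) + \<mu> * d x)\<^sup>2 / g x))"
    unfolding eq by (intro Bochner_Integration.integrable_add integrable_mult_right int)
  have "(\<lambda>y. LINT x|lborel. gauss \<tau> (y - x) * ((\<beta> * ((y - x) / \<tau> * g x) + \<mu> * d x)\<^sup>2 / g x))
    = (\<lambda>y. \<beta>\<^sup>2 / \<tau>\<^sup>2 * conv (\<lambda>z. z\<^sup>2 * gauss \<tau> z) g y + 2 * \<beta> * \<mu> / \<tau> * conv (\<lambda>z. z * gauss \<tau> z) d y
       + \<mu>\<^sup>2 * conv (gauss \<tau>) (\<lambda>x. (d x)\<^sup>2 / g x) y)"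
    unfolding eq conv_def
    by (simp only: Bochner_Integration.integral_add integrable_mult_right Bochner_Integration.integrable_add int
        integral_mult_right_zero)
  moreover have "has_bochner_integral lborel \<dots>
      (\<beta>\<^sup>2 / \<tau>\<^sup>2 * (\<tau> * 1) + 2 * \<beta> * \<mu> / \<tau> * (0 * (LINT x|lborel. d x)) + \<mu>\<^sup>2 * (1 * fisher))"
    using has_bochner_integral_conv[OF gauss_second_moment(1)[OF \<tau>] g_int]
      has_bochner_integral_conv[OF gauss_first_moment(1)[OF \<tau>] d_int]
      has_bochner_integral_conv[OF gauss_integral(1)[OF \<tau>] fisher_int]
    by (intro has_bochner_integral_add has_bochner_integral_mult_right)
      (simp_all add: gauss_integral gauss_first_moment gauss_second_moment \<tau> g_total fisher_def)
  ultimately show "has_bochner_integral lborel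
      (\<lambda>y. LINT x|lborel. gauss \<tau> (y - x) * ((\<beta> * ((y - x) / \<tau> * g x) + \<mu> * d x)\<^sup>2 / g x))
      (\<beta>\<^sup>2 / \<tau> + \<mu>\<^sup>2 * fisher)"
    using \<tau> by (simp add: power2_eq_square)
qed

text \<open>The derivative acts on the smooth bounded kernel, so differentiation under the integral
  asks only integrability of \<open>g\<close>.\<close>

definition m' :: "real \<Rightarrow> real" where
  "m' = conv (\<lambda>z. - (z / \<tau>) * gauss \<tau> z) g"

lemma gauss'_bounded: "\<bar>- (z / \<tau>) * gauss \<tau> z\<bar> \<le> (1 + 2 * \<tau>) * gauss \<tau> 0 / \<tau>"
  using abs_gauss_le[OF \<tau>, of z] gauss_pos[OF \<tau>, of z] \<tau>
  by (simp add: abs_mult divide_right_mono)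

lemma continuous_gauss': "continuous_on UNIV (\<lambda>z. - (z / \<tau>) * gauss \<tau> z)"
  by (intro continuous_intros continuous_gauss[OF \<tau>]) (use \<tau> in auto)

lemma abs_gauss_le': "\<bar>gauss \<tau> z\<bar> \<le> gauss \<tau> 0"
  using gauss_le[OF \<tau>, of z] gauss_pos[OF \<tau>, of z] by simp

lemma m_deriv: "(m has_real_derivative m' y) (at y)"
  unfolding m'_def
  by (rule conv_has_derivative[OF gauss_deriv[OF \<tau>] continuous_gauss' abs_gauss_le' gauss'_bounded g_int])

lemma isCont_m': "isCont m' y"
  unfolding m'_def by (rule isCont_conv[OF continuous_gauss' gauss'_bounded g_int])

lemma gauss_reflect_deriv:
  "((\<lambda>x. gauss \<tau> (y - x)) has_real_derivative (y - x) / \<tau> * gauss \<tau> (y - x)) (at x)"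
proof -
  have "((\<lambda>x. y - x) has_real_derivative - 1) (at x)"
    by (auto intro!: derivative_eq_intros)
  from DERIV_chain[OF gauss_deriv[OF \<tau>, of "y - x"] this] show ?thesis
    by (simp add: comp_def)
qed

lemma gauss_reflect_tendsto:
  "((\<lambda>x. gauss \<tau> (y - x)) \<longlongrightarrow> 0) at_top" "((\<lambda>x. gauss \<tau> (y - x)) \<longlongrightarrow> 0) at_bot"
proof -
  have sym: "gauss \<tau> (y - x) = gauss \<tau> (- y + x)" for x
    by (simp add: gauss_def power2_eq_square algebra_simps)
  show "((\<lambda>x. gauss \<tau> (y - x)) \<longlongrightarrow> 0) at_top"
    unfolding sym
    by (rule filterlim_compose[OF gauss_tendsto(1)[OF \<tau>]])
      (rule filterlim_tendsto_add_at_top[OF tendsto_const filterlim_ident])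
  have "filterlim (\<lambda>x. - y + x) at_bot at_bot"
    using filterlim_tendsto_add_at_top[OF tendsto_const[of y] filterlim_uminus_at_top_at_bot]
    by (simp add: filterlim_uminus_at_bot)
  then show "((\<lambda>x. gauss \<tau> (y - x)) \<longlongrightarrow> 0) at_bot"
    unfolding sym by (rule filterlim_compose[OF gauss_tendsto(2)[OF \<tau>]])
qed

lemma continuous_gauss_reflect: "continuous_on UNIV (\<lambda>x. gauss \<tau> (y - x))"
  by (rule continuous_on_compose2[OF continuous_gauss[OF \<tau>, of UNIV]]) (auto intro!: continuous_intros)

lemma integrable_gauss_reflect:
  "integrable lborel (\<lambda>x. gauss \<tau> (y - x))" "integrable lborel (\<lambda>x. (y - x) * gauss \<tau> (y - x))"
  using lborel_integrable_real_affine[OF gauss_integral(1)[OF \<tau>], of "-1" y]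
    lborel_integrable_real_affine[OF gauss_first_moment(1)[OF \<tau>], of "-1" y]
  by simp_all

text \<open>Integration by parts moves the derivative from the kernel to \<open>g\<close>. Having
  both representations of \<open>m'\<close> is what allows the two scores to be mixed with arbitrary
  weights.\<close>

lemma m'_eq: "m' y = conv (gauss \<tau>) d y"
proof -
  have "(LINT x|lborel. (y - x) / \<tau> * gauss \<tau> (y - x) * g x) = - (LINT x|lborel. gauss \<tau> (y - x) * d x)"
  proof (rule integral_by_parts_line[OF d_int weak_deriv])
    show "continuous_on UNIV (\<lambda>x. (y - x) / \<tau> * gauss \<tau> (y - x))"
      by (intro continuous_intros continuous_gauss_reflect) (use \<tau> in auto)
    show "integrable lborel (\<lambda>x. (y - x) / \<tau> * gauss \<tau> (y - x))"
      using integrable_mult_right[OF integrable_gauss_reflect(2), of "1 / \<tau>"] by simp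
  qed (use gauss_reflect_deriv gauss_reflect_tendsto in auto)
  then show ?thesis unfolding m'_def conv_def by simp
qed

text \<open>
  Stam's inequality with a Gaussian: the score of the convolution is the conditional expectation
  of every convex combination of the two scores.
\<close>

lemma stam_pointwise:
  "(m' y)\<^sup>2 / m y \<le> (LINT x|lborel. gauss \<tau> (y - x) * ((\<beta> * ((y - x) / \<tau> * g x) + (\<beta> - 1) * d x)\<^sup>2 / g x))"
    (is "_ \<le> ?E")
proof -
  let ?b = "\<lambda>x. \<beta> * ((y - x) / \<tau> * g x) + (\<beta> - 1) * d x"
  \<comment> \<open>Cauchy-Schwarz in linearised form, 2 t b - t^2 g \<le> b^2 / g; this
    \<open>t\<close> maximises the integrated left-hand side.\<close>
  define t where "t = - m' y / m y"
  have int: "integrable lborel (\<lambda>x. (y - x) * gauss \<tau> (y - x) * g x)" "integrable lborel (\<lambda>x. gauss \<tau> (y - x) * d x)"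
    "integrable lborel (\<lambda>x. gauss \<tau> (y - x) * g x)"
    by (intro gauss_mult_integrable g_int d_int)+
  have eq: "gauss \<tau> (y - x) * ?b x
      = \<beta> / \<tau> * ((y - x) * gauss \<tau> (y - x) * g x) + (\<beta> - 1) * (gauss \<tau> (y - x) * d x)" for x
    by (simp add: algebra_simps add_divide_distrib diff_divide_distrib)
  have "has_bochner_integral lborel (\<lambda>x. gauss \<tau> (y - x) * ?b x)
      (\<beta> / \<tau> * (LINT x|lborel. (y - x) * gauss \<tau> (y - x) * g x) + (\<beta> - 1) * (LINT x|lborel. gauss \<tau> (y - x) * d x))"
    unfolding eq
    by (intro has_bochner_integral_add has_bochner_integral_mult_right has_bochner_integral_integrable int)
  also have "\<beta> / \<tau> * (LINT x|lborel. (y - x) * gauss \<tau> (y - x) * g x) = - \<beta> * m' y"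
    unfolding m'_def conv_def by simp
  also have "(LINT x|lborel. gauss \<tau> (y - x) * d x) = m' y"
    by (simp add: m'_eq conv_def)
  \<comment> \<open>The two representations contribute \<open>- \<beta> * m' y\<close> and
    \<open>(\<beta> - 1) * m' y\<close>, so the sum does not depend on \<beta>.\<close>
  finally have b: "has_bochner_integral lborel (\<lambda>x. gauss \<tau> (y - x) * ?b x) (- m' y)"
    by (simp add: algebra_simps)
  have "has_bochner_integral lborel
      (\<lambda>x. 2 * t * (gauss \<tau> (y - x) * ?b x) - t\<^sup>2 * (gauss \<tau> (y - x) * g x)) (2 * t * (- m' y) - t\<^sup>2 * m y)"
    unfolding conv_def
    by (intro has_bochner_integral_diff has_bochner_integral_mult_right b has_bochner_integral_integrable int)
  moreover have "2 * t * (gauss \<tau> (y - x) * ?b x) - t\<^sup>2 * (gauss \<tau> (y - x) * g x)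
      \<le> gauss \<tau> (y - x) * ((?b x)\<^sup>2 / g x)" for x
  proof (cases "g x = 0")
    case False
    then have g: "0 < g x" using nonneg[of x] by simp
    have "b\<^sup>2 / g x - 2 * t * b + t\<^sup>2 * g x = (b - t * g x)\<^sup>2 / g x" for b
      using g by (simp add: power2_eq_square field_simps)
    then have "(?b x)\<^sup>2 / g x - 2 * t * ?b x + t\<^sup>2 * g x = (?b x - t * g x)\<^sup>2 / g x" .
    also have "0 \<le> \<dots>" using g by simp
    finally have "0 \<le> gauss \<tau> (y - x) * ((?b x)\<^sup>2 / g x - 2 * t * ?b x + t\<^sup>2 * g x)"
      using gauss_pos[OF \<tau>, of "y - x"] by simp
    then show ?thesis by (simp add: algebra_simps)
  qed (simp add: d_zero)
  ultimately have "2 * t * (- m' y) - t\<^sup>2 * m y \<le> ?E"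
    using quadratic_kernel(1)[of y \<beta> "\<beta> - 1"]
    by (metis (no_types, lifting) has_bochner_integral_iff integral_mono)
  moreover have "2 * t * (- m' y) - t\<^sup>2 * m y = (m' y)\<^sup>2 / m y"
    using m_pos[of y] by (simp add: t_def power2_eq_square field_simps)
  ultimately show ?thesis by simp
qed

lemma m_continuous: "continuous_on UNIV m" and m'_continuous: "continuous_on UNIV m'"
  using DERIV_isCont[OF m_deriv] isCont_m' by (auto simp: continuous_at_imp_continuous_on)

text \<open>With weight \<beta> = 1 only the Gaussian score is left, and the dominating function has
  integral 1 / \<tau>. The unsimplified \<open>1 - 1\<close> matches the shape
  \<open>\<beta> - 1\<close> of the pointwise bound.\<close>

lemma integrable_m_fisher: "integrable lborel (\<lambda>y. (m' y)\<^sup>2 / m y)"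
proof (rule Bochner_Integration.integrable_bound)
  show "integrable lborel (\<lambda>y. LINT x|lborel. gauss \<tau> (y - x) * ((1 * ((y - x) / \<tau> * g x) + (1 - 1) * d x)\<^sup>2 / g x))"
    using quadratic_kernel(2)[of 1 "1 - 1"] by (simp only: has_bochner_integral_iff)
  show "(\<lambda>y. (m' y)\<^sup>2 / m y) \<in> borel_measurable lborel"
    using borel_measurable_continuous_onI[OF m_continuous] borel_measurable_continuous_onI[OF m'_continuous]
    by simp
  show "AE y in lborel. norm ((m' y)\<^sup>2 / m y)
      \<le> norm (LINT x|lborel. gauss \<tau> (y - x) * ((1 * ((y - x) / \<tau> * g x) + (1 - 1) * d x)\<^sup>2 / g x))"
  proof (rule AE_I2)
    fix y
    have "0 \<le> (m' y)\<^sup>2 / m y" using m_pos[of y] by simp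
    with stam_pointwise[of y 1] show "norm ((m' y)\<^sup>2 / m y)
      \<le> norm (LINT x|lborel. gauss \<tau> (y - x) * ((1 * ((y - x) / \<tau> * g x) + (1 - 1) * d x)\<^sup>2 / g x))"
      unfolding real_norm_def by linarith
  qed
qed

lemma fisher_nonneg: "0 \<le> fisher"
  unfolding fisher_def by (rule integral_nonneg_AE) (simp add: nonneg)

lemma stam: "(LINT y|lborel. (m' y)\<^sup>2 / m y) \<le> fisher / (1 + \<tau> * fisher)"
proof -
  \<comment> \<open>The minimiser of \<beta>^2 / \<tau> + (\<beta> - 1)^2 I, where I is
    \<open>fisher\<close>.\<close>
  define \<beta> where "\<beta> = \<tau> * fisher / (1 + \<tau> * fisher)"
  have p: "0 < 1 + \<tau> * fisher"
    using fisher_nonneg \<tau> by (simp add: add_pos_nonneg)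
  have "(LINT y|lborel. (m' y)\<^sup>2 / m y)
      \<le> (LINT y|lborel. LINT x|lborel. gauss \<tau> (y - x) * ((\<beta> * ((y - x) / \<tau> * g x) + (\<beta> - 1) * d x)\<^sup>2 / g x))"
    using quadratic_kernel(2)[of \<beta> "\<beta> - 1"]
    by (intro integral_mono integrable_m_fisher stam_pointwise) (simp add: has_bochner_integral_iff)
  also have "\<dots> = \<beta>\<^sup>2 / \<tau> + (\<beta> - 1)\<^sup>2 * fisher"
    using quadratic_kernel(2)[of \<beta> "\<beta> - 1"] by (simp add: has_bochner_integral_iff)
  also have "\<dots> = fisher / (1 + \<tau> * fisher)"
  proof -
    define D where "D = 1 + \<tau> * fisher"
    have D: "D \<noteq> 0" "\<beta> = \<tau> * fisher / D" "\<beta> - 1 = - 1 / D"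
      using p by (auto simp: D_def \<beta>_def field_simps)
    have "\<beta>\<^sup>2 / \<tau> + (\<beta> - 1)\<^sup>2 * fisher = fisher * (1 + \<tau> * fisher) / D\<^sup>2"
      unfolding D(3) unfolding D(2) using D(1) \<tau> by (simp add: power2_eq_square field_simps)
    also have "\<dots> = fisher / D"
      using D(1) by (simp add: D_def [symmetric] power2_eq_square)
    finally show ?thesis by (simp add: D_def)
  qed
  finally show ?thesis .
qed

text \<open>
  Squeezing the distribution function into \<open>[\<epsilon>, 1 - \<epsilon>]\<close> keeps the transport map \<open>T\<close> bounded,
  so that the boundary terms in the integration by parts vanish.
\<close>

lemma transport_bound_eps:
  fixes y a \<epsilon> :: real
  defines "q \<equiv> \<lambda>x. gauss \<tau> (y - x) * g x"
  assumes a: "0 < a" and \<epsilon>: "0 < \<epsilon>" "\<epsilon> < 1 / 2"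
    and ent: "integrable lborel (\<lambda>x. q x * ln (q x))"
  shows "(LINT x|lborel. q x * ln (q x)) - m y * ln (m y)
    \<le> (- ln (2 * pi * a) / 2 - 1 - ln (1 - 2 * \<epsilon>)) * m y
      + a / 2 * (LINT x|lborel. gauss \<tau> (y - x) * ((1 * ((y - x) / \<tau> * g x) + 1 * d x)\<^sup>2 / g x))"
proof -
  interpret target: positive_density "gauss a" by (rule positive_density_gauss[OF a])
  note [measurable] = gauss_measurable[OF \<tau>]
  define \<kappa> where "\<kappa> = 1 - 2 * \<epsilon>"
  define p where "p = (\<lambda>x. q x / m y)"
  define F where "F = primitive p"
  \<comment> \<open>Without the squeeze this is the increasing rearrangement of \<open>p\<close>
    into \<open>gauss a\<close>. The squeeze costs the factor \<kappa> in \<open>T'\<close>, hence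
    the term \<open>- ln \<kappa>\<close>, which tends to 0 with \<epsilon>.\<close>
  define T where "T = (\<lambda>x. target.quantile (\<epsilon> + \<kappa> * F x))"
  define T' where "T' = (\<lambda>x. \<kappa> * (q x / m y) / gauss a (T x))"
  define K where "K = max \<bar>target.quantile \<epsilon>\<bar> \<bar>target.quantile (1 - \<epsilon>)\<bar>"
  define u where "u = (\<lambda>x. gauss \<tau> (y - x) * T x)"
  define u' where "u' = (\<lambda>x. (y - x) / \<tau> * gauss \<tau> (y - x) * T x + gauss \<tau> (y - x) * T' x)"
  have \<kappa>: "0 < \<kappa>" "\<kappa> \<le> 1" using \<epsilon> by (auto simp: \<kappa>_def)
  note m = m_pos[of y]
  have q_int: "has_bochner_integral lborel q (m y)"
    unfolding q_def conv_def by (intro has_bochner_integral_integrable gauss_mult_integrable g_int)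
  have q_cont: "isCont q x" for x
    unfolding q_def using isCont_g continuous_gauss_reflect[of y]
    by (intro continuous_intros) (auto simp: continuous_on_eq_continuous_at)
  have p_int: "integrable lborel p" "(LINT x|lborel. p x) = 1"
    using q_int m by (auto simp: p_def has_bochner_integral_iff)
  have p_nonneg: "0 \<le> p x" for x
    using gauss_mult_g_nonneg[of y x] m by (simp add: p_def q_def)
  have F_deriv: "(F has_real_derivative q x / m y) (at x)" for x
  proof -
    have "isCont p x" unfolding p_def using m by (intro continuous_intros q_cont) auto
    from primitive_has_derivative[OF p_int(1) this] show ?thesis by (simp add: F_def p_def)
  qed
  have F_bounds: "0 \<le> F x" "F x \<le> 1" for x
    using primitive_bounds[OF p_int(1) p_nonneg] p_int(2) by (auto simp: F_def)
  have v: "\<epsilon> \<le> \<epsilon> + \<kappa> * F x" "\<epsilon> + \<kappa> * F x \<le> 1 - \<epsilon>" for x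
  proof -
    have "\<kappa> * F x \<le> \<kappa> * 1" by (rule mult_left_mono) (use F_bounds \<kappa> in auto)
    then show "\<epsilon> + \<kappa> * F x \<le> 1 - \<epsilon>" by (simp add: \<kappa>_def)
    show "\<epsilon> \<le> \<epsilon> + \<kappa> * F x" using F_bounds[of x] \<kappa> by simp
  qed
  have v01: "0 < \<epsilon> + \<kappa> * F x" "\<epsilon> + \<kappa> * F x < 1" for x
    using v[of x] \<epsilon> by linarith+
  have T_deriv: "(T has_real_derivative T' x) (at x)" for x
  proof -
    have "((\<lambda>x. \<epsilon> + \<kappa> * F x) has_real_derivative \<kappa> * (q x / m y)) (at x)"
      by (auto intro!: derivative_eq_intros F_deriv)
    from DERIV_chain[OF target.quantile_deriv[OF v01] this] show ?thesis
      by (simp add: T_def T'_def comp_def divide_inverse mult_ac)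
  qed
  have T_cont: "isCont T x" for x using T_deriv by (rule DERIV_isCont)
  have T_bound: "\<bar>T x\<bar> \<le> K" for x
  proof -
    have "target.quantile \<epsilon> \<le> T x" "T x \<le> target.quantile (1 - \<epsilon>)"
      unfolding T_def using v[of x] v01[of x] \<epsilon> by (auto intro!: target.quantile_mono)
    then show ?thesis unfolding K_def by linarith
  qed
  have K: "0 \<le> K" using T_bound[of 0] by linarith
  \<comment> \<open>A bounded \<open>T\<close> stays where the target density is bounded below, so
    \<open>T'\<close> is at most a multiple of \<open>q\<close>.\<close>
  have ga_T: "gauss a K \<le> gauss a (T x)" for x
  proof -
    have "(T x)\<^sup>2 \<le> K\<^sup>2" using power_mono[OF T_bound[of x], of 2] by simp
    then show ?thesis unfolding gauss_def using a
      by (intro mult_left_mono) (auto simp: divide_right_mono)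
  qed
  have ga_T_cont: "isCont (\<lambda>x. gauss a (T x)) x" for x
    using isCont_o2[OF T_cont, of x "gauss a"] target.isCont_p by blast
  have T'_cont: "isCont T' x" for x
    unfolding T'_def by (intro continuous_intros q_cont ga_T_cont) (use m gauss_pos[OF a, of "T x"] in auto)
  have u_deriv: "(u has_real_derivative u' x) (at x)" for x
    unfolding u_def u'_def
    using DERIV_mult[OF gauss_reflect_deriv T_deriv] by (simp add: add.commute mult_ac)
  have u'_cont: "continuous_on UNIV u'"
    unfolding u'_def using T_cont T'_cont continuous_gauss_reflect \<tau>
    by (intro continuous_intros) (auto intro: continuous_at_imp_continuous_on)
  have T_meas [measurable]: "T \<in> borel_measurable borel"
    using T_cont by (intro borel_measurable_continuous_onI) (auto intro: continuous_at_imp_continuous_on)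
  have gaT_meas [measurable]: "(\<lambda>x. gauss a (T x)) \<in> borel_measurable borel"
    using ga_T_cont by (intro borel_measurable_continuous_onI) (auto intro: continuous_at_imp_continuous_on)
  have u'_int: "integrable lborel u'"
  proof -
    have 1: "integrable lborel (\<lambda>x. T x * ((y - x) * gauss \<tau> (y - x)))"
      by (rule integrable_bounded_mult[OF _ T_bound integrable_gauss_reflect(2)]) simp
    have 2: "integrable lborel (\<lambda>x. gauss \<tau> (y - x) / gauss a (T x) * (gauss \<tau> (y - x) * g x))"
    proof (rule integrable_bounded_mult[OF _ _ gauss_mult_integrable(1)[OF g_int]])
      show "\<bar>gauss \<tau> (y - x) / gauss a (T x)\<bar> \<le> gauss \<tau> 0 / gauss a K" for x
        using frac_le[OF _ gauss_le[OF \<tau>, of "y - x"] gauss_pos[OF a] ga_T[of x]]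
          gauss_pos[OF \<tau>, of "y - x"] gauss_pos[OF \<tau>, of 0] gauss_pos[OF a, of "T x"]
        by (simp add: abs_of_pos)
    qed measurable
    have "u' = (\<lambda>x. 1 / \<tau> * (T x * ((y - x) * gauss \<tau> (y - x)))
        + \<kappa> / m y * (gauss \<tau> (y - x) / gauss a (T x) * (gauss \<tau> (y - x) * g x)))"
      by (simp add: u'_def T'_def q_def fun_eq_iff mult_ac)
    then show ?thesis
      using Bochner_Integration.integrable_add[OF integrable_mult_right[OF 1, of "1 / \<tau>"]
          integrable_mult_right[OF 2, of "\<kappa> / m y"]] by simp
  qed
  have u_abs: "\<bar>u x\<bar> \<le> K * gauss \<tau> (y - x)" for x
    using mult_right_mono[OF T_bound[of x], of "gauss \<tau> (y - x)"] gauss_pos[OF \<tau>, of "y - x"]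
    by (simp add: u_def abs_mult mult_ac)
  have u_lim: "(u \<longlongrightarrow> 0) F" if "((\<lambda>x. gauss \<tau> (y - x)) \<longlongrightarrow> 0) F" for F
  proof (rule Lim_null_comparison)
    show "((\<lambda>x. K * gauss \<tau> (y - x)) \<longlongrightarrow> 0) F"
      using tendsto_mult[OF tendsto_const[of K] that] by simp
  qed (use u_abs in simp)
  have ibp: "(LINT x|lborel. u' x * g x) = - (LINT x|lborel. u x * d x)"
    by (rule integral_by_parts_line[OF d_int weak_deriv u_deriv u'_cont u'_int
          u_lim[OF gauss_reflect_tendsto(1)] u_lim[OF gauss_reflect_tendsto(2)]])
  have int1: "integrable lborel (\<lambda>x. u' x * g x)"
  proof -
    obtain M where M: "\<And>x. g x \<le> M" using g_bounded by blast
    have "integrable lborel (\<lambda>x. g x * u' x)"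
      by (rule integrable_bounded_mult[OF _ _ u'_int, of _ M]) (use M nonneg in auto)
    then show ?thesis by (simp add: mult.commute)
  qed
  have int2: "integrable lborel (\<lambda>x. u x * d x)"
  proof (rule integrable_bounded_mult[OF _ _ d_int])
    show "u \<in> borel_measurable borel" unfolding u_def by measurable
    show "\<bar>u x\<bar> \<le> K * gauss \<tau> 0" for x
      using u_abs[of x] mult_left_mono[OF gauss_le[OF \<tau>, of "y - x"] K] by linarith
  qed
  \<comment> \<open>The integrand is the derivative of \<open>u * g\<close>, that is of
    \<open>T * q\<close>. Its integral contains the only terms in which the transport map would
    survive.\<close>
  have boundary: "has_bochner_integral lborel (\<lambda>x. u' x * g x + u x * d x) 0"
    using has_bochner_integral_add[OF has_bochner_integral_integrable[OF int1]
        has_bochner_integral_integrable[OF int2]] ibp by simp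
  \<comment> \<open>The Gaussian times \<open>?s\<close> is the derivative of \<open>q\<close>. The
    factors 1 match the case \<beta> = \<mu> = 1 of \<open>quadratic_kernel\<close>.\<close>
  let ?s = "\<lambda>x. 1 * ((y - x) / \<tau> * g x) + 1 * d x"
  have pointwise: "q x * ln (q x) - ln (m y) * q x
      \<le> (- ln (2 * pi * a) / 2 - 1 - ln \<kappa>) * q x + (u' x * g x + u x * d x)
        + a / 2 * (gauss \<tau> (y - x) * ((?s x)\<^sup>2 / g x))" for x
  proof -
    have "T' x * q x + T x * (gauss \<tau> (y - x) * ?s x) = u' x * g x + u x * d x"
      by (simp add: u_def u'_def q_def algebra_simps)
    moreover have "q x * ln (q x) - q x * ln (m y)
      \<le> (- ln (2 * pi * a) / 2 - 1 - ln \<kappa>) * q x + (T' x * q x + T x * (gauss \<tau> (y - x) * ?s x))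
        + a / 2 * (gauss \<tau> (y - x) * ((?s x)\<^sup>2 / g x))"
      by (rule transport_pointwise)
        (use gauss_pos[OF \<tau>] nonneg m a \<kappa> d_zero in \<open>auto simp: q_def T'_def\<close>)
    ultimately show ?thesis by (simp only: mult.commute)
  qed
  have lhs: "has_bochner_integral lborel (\<lambda>x. q x * ln (q x) - ln (m y) * q x)
      ((LINT x|lborel. q x * ln (q x)) - ln (m y) * m y)"
    by (intro has_bochner_integral_diff has_bochner_integral_mult_right q_int
        has_bochner_integral_integrable ent)
  have rhs: "has_bochner_integral lborel (\<lambda>x. (- ln (2 * pi * a) / 2 - 1 - ln \<kappa>) * q x
        + (u' x * g x + u x * d x) + a / 2 * (gauss \<tau> (y - x) * ((?s x)\<^sup>2 / g x)))
      ((- ln (2 * pi * a) / 2 - 1 - ln \<kappa>) * m y + 0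
        + a / 2 * (LINT x|lborel. gauss \<tau> (y - x) * ((?s x)\<^sup>2 / g x)))"
    by (intro has_bochner_integral_add has_bochner_integral_mult_right q_int boundary
        has_bochner_integral_integrable quadratic_kernel(1))
  have "(LINT x|lborel. q x * ln (q x)) - ln (m y) * m y
    \<le> (- ln (2 * pi * a) / 2 - 1 - ln \<kappa>) * m y + 0
        + a / 2 * (LINT x|lborel. gauss \<tau> (y - x) * ((?s x)\<^sup>2 / g x))"
    by (rule has_bochner_integral_mono[OF lhs rhs]) (rule pointwise)
  then show ?thesis by (simp add: \<kappa>_def mult.commute)
qed

text \<open>Only \<open>ln (1 - 2 * \<epsilon>)\<close> depends on \<epsilon>, and it vanishes in
  the limit. The parameter \<open>a\<close> is not optimised for each \<open>y\<close>: with a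
  common \<open>a\<close> the bound is linear in the conditional Fisher information and can be
  averaged directly.\<close>

lemma transport_bound:
  fixes y a :: real
  defines "q \<equiv> \<lambda>x. gauss \<tau> (y - x) * g x"
  assumes a: "0 < a" and ent: "integrable lborel (\<lambda>x. q x * ln (q x))"
  shows "(LINT x|lborel. q x * ln (q x)) - m y * ln (m y)
    \<le> (- ln (2 * pi * a) / 2 - 1) * m y
      + a / 2 * (LINT x|lborel. gauss \<tau> (y - x) * ((1 * ((y - x) / \<tau> * g x) + 1 * d x)\<^sup>2 / g x))"
    (is "?L \<le> ?C * m y + ?R")
proof (rule tendsto_lowerbound)
  have "((\<lambda>\<epsilon>. (?C - ln (1 - 2 * \<epsilon>)) * m y + ?R) \<longlongrightarrow> (?C - ln (1 - 2 * 0)) * m y + ?R) (at_right 0)"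
    by (intro tendsto_intros) auto
  then show "((\<lambda>\<epsilon>. (?C - ln (1 - 2 * \<epsilon>)) * m y + ?R) \<longlongrightarrow> ?C * m y + ?R) (at_right 0)"
    by simp
  have "\<forall>\<^sub>F \<epsilon> in at_right 0. \<epsilon> \<in> {0<..<1/2::real}"
    by (rule eventually_at_right_real) simp
  then show "\<forall>\<^sub>F \<epsilon> in at_right 0. ?L \<le> (?C - ln (1 - 2 * \<epsilon>)) * m y + ?R"
  proof eventually_elim
    case (elim \<epsilon>)
    then show ?case
      using transport_bound_eps[OF a, of \<epsilon> y] ent by (simp add: q_def)
  qed
qed simp

section \<open>Growth of the entropy and the decrease of the product\<close>

context
  assumes entropy_int: "integrable lborel (\<lambda>x. g x * ln (g x))"
begin

text \<open>The logarithm of the product splits, so the negative joint entropy is the sum of those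
  of the Gaussian and of \<open>g\<close>. The 1 / 2 is the second moment \<tau> divided by 2
  \<tau>.\<close>

lemma joint_entropy:
  shows "integrable lborel (\<lambda>x. gauss \<tau> (y - x) * g x * ln (gauss \<tau> (y - x) * g x))"
    and "has_bochner_integral lborel
      (\<lambda>y. LINT x|lborel. gauss \<tau> (y - x) * g x * ln (gauss \<tau> (y - x) * g x))
      (- ln (2 * pi * \<tau>) / 2 - 1 / 2 + (LINT x|lborel. g x * ln (g x)))"
proof -
  have eq: "gauss \<tau> (y - x) * g x * ln (gauss \<tau> (y - x) * g x)
    = - ln (2 * pi * \<tau>) / 2 * (gauss \<tau> (y - x) * g x)
      + - 1 / (2 * \<tau>) * ((y - x)\<^sup>2 * gauss \<tau> (y - x) * g x)
      + gauss \<tau> (y - x) * (g x * ln (g x))" for x y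
  proof (cases "g x = 0")
    case False
    then have "0 < g x" using nonneg[of x] by simp
    then have "ln (gauss \<tau> (y - x) * g x) = - ln (2 * pi * \<tau>) / 2 - (y - x)\<^sup>2 / (2 * \<tau>) + ln (g x)"
      using gauss_pos[OF \<tau>, of "y - x"] by (simp add: ln_mult ln_gauss[OF \<tau>])
    then show ?thesis by (simp only:) (simp add: algebra_simps)
  qed simp
  note int = gauss_mult_integrable(1)[OF g_int] gauss_mult_integrable(3)[OF g_int]
    gauss_mult_integrable(1)[OF entropy_int]
  show "integrable lborel (\<lambda>x. gauss \<tau> (y - x) * g x * ln (gauss \<tau> (y - x) * g x))"
    unfolding eq by (intro Bochner_Integration.integrable_add integrable_mult_right int)
  have "(\<lambda>y. LINT x|lborel. gauss \<tau> (y - x) * g x * ln (gauss \<tau> (y - x) * g x))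
    = (\<lambda>y. - ln (2 * pi * \<tau>) / 2 * m y + - 1 / (2 * \<tau>) * conv (\<lambda>z. z\<^sup>2 * gauss \<tau> z) g y
        + conv (gauss \<tau>) (\<lambda>x. g x * ln (g x)) y)"
    unfolding eq conv_def
    by (simp only: Bochner_Integration.integral_add integrable_mult_right Bochner_Integration.integrable_add int
        integral_mult_right_zero)
  moreover have "has_bochner_integral lborel \<dots>
      (- ln (2 * pi * \<tau>) / 2 * 1 + - 1 / (2 * \<tau>) * (\<tau> * 1) + 1 * (LINT x|lborel. g x * ln (g x)))"
    using has_bochner_integral_m has_bochner_integral_conv[OF gauss_second_moment(1)[OF \<tau>] g_int]
      has_bochner_integral_conv[OF gauss_integral(1)[OF \<tau>] entropy_int]
    by (intro has_bochner_integral_add has_bochner_integral_mult_right)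
      (simp_all add: gauss_integral gauss_second_moment \<tau> g_total)
  ultimately show "has_bochner_integral lborel
      (\<lambda>y. LINT x|lborel. gauss \<tau> (y - x) * g x * ln (gauss \<tau> (y - x) * g x))
      (- ln (2 * pi * \<tau>) / 2 - 1 / 2 + (LINT x|lborel. g x * ln (g x)))"
    using \<tau> by simp
qed

text \<open>
  The constant \<open>a\<close> is the reciprocal of the mean Fisher information \<open>1 / \<tau> + fisher\<close> of the
  conditional densities, which makes the averaged transport bound sharp.
\<close>

lemma entropy_growth:
  shows "integrable lborel (\<lambda>y. m y * ln (m y))"
    and "(LINT x|lborel. g x * ln (g x)) - ln (1 + \<tau> * fisher) / 2 \<le> (LINT y|lborel. m y * ln (m y))"
proof -
  define a where "a = \<tau> / (1 + \<tau> * fisher)"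
  define C where "C = - ln (2 * pi * a) / 2 - 1"
  define A where "A = (\<lambda>y. LINT x|lborel. gauss \<tau> (y - x) * g x * ln (gauss \<tau> (y - x) * g x))"
  define B where "B = (\<lambda>y. LINT x|lborel. gauss \<tau> (y - x) * ((1 * ((y - x) / \<tau> * g x) + 1 * d x)\<^sup>2 / g x))"
  define H where "H = (LINT x|lborel. g x * ln (g x))"
  have p: "0 < 1 + \<tau> * fisher"
    using fisher_nonneg \<tau> by (simp add: add_pos_nonneg)
  then have a: "0 < a" using \<tau> by (simp add: a_def)
  have lower: "has_bochner_integral lborel (\<lambda>y. A y - C * m y - a / 2 * B y)
      ((- ln (2 * pi * \<tau>) / 2 - 1 / 2 + H) - C * 1 - a / 2 * (1\<^sup>2 / \<tau> + 1\<^sup>2 * fisher))"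
    unfolding A_def B_def H_def
    by (intro has_bochner_integral_diff has_bochner_integral_mult_right has_bochner_integral_m
        joint_entropy(2) quadratic_kernel(2))
  have le: "A y - C * m y - a / 2 * B y \<le> m y * ln (m y)" for y
    using transport_bound[OF a joint_entropy(1), of y] by (simp add: A_def B_def C_def)
  \<comment> \<open>Together with the transport bound from below, this encloses
    \<open>m y * ln (m y)\<close> between two integrable functions.\<close>
  have ub: "m y * ln (m y) \<le> m y * ln (gauss \<tau> 0)" for y
    using m_pos[of y] m_le[of y] by (intro mult_left_mono) auto
  have m_meas [measurable]: "m \<in> borel_measurable borel"
    by (rule borel_measurable_continuous_onI[OF m_continuous])
  show int: "integrable lborel (\<lambda>y. m y * ln (m y))"
  proof (rule Bochner_Integration.integrable_bound)
    show "integrable lborel (\<lambda>y. \<bar>A y - C * m y - a / 2 * B y\<bar> + \<bar>m y * ln (gauss \<tau> 0)\<bar>)"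
      using lower has_bochner_integral_m
      by (intro Bochner_Integration.integrable_add integrable_abs integrable_mult_left)
        (auto simp: has_bochner_integral_iff)
    show "AE y in lborel. norm (m y * ln (m y))
        \<le> norm (\<bar>A y - C * m y - a / 2 * B y\<bar> + \<bar>m y * ln (gauss \<tau> 0)\<bar>)"
    proof (rule AE_I2)
      fix y
      show "norm (m y * ln (m y)) \<le> norm (\<bar>A y - C * m y - a / 2 * B y\<bar> + \<bar>m y * ln (gauss \<tau> 0)\<bar>)"
        unfolding real_norm_def using le[of y] ub[of y] by linarith
    qed
  qed measurable
  have "(- ln (2 * pi * \<tau>) / 2 - 1 / 2 + H) - C * 1 - a / 2 * (1\<^sup>2 / \<tau> + 1\<^sup>2 * fisher)
      \<le> (LINT y|lborel. m y * ln (m y))"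
    by (rule has_bochner_integral_mono[OF lower has_bochner_integral_integrable[OF int]]) (rule le)
  \<comment> \<open>This half and the half in the Gaussian entropy cancel the 1 in
    \<open>C\<close>.\<close>
  also have "a / 2 * (1\<^sup>2 / \<tau> + 1\<^sup>2 * fisher) = 1 / 2"
  proof -
    have "1\<^sup>2 / \<tau> + 1\<^sup>2 * fisher = 1 / a" using \<tau> p by (simp add: a_def field_simps)
    then show ?thesis using a by simp
  qed
  also have "C = - ln (2 * pi * \<tau>) / 2 + ln (1 + \<tau> * fisher) / 2 - 1"
    using \<tau> p by (simp add: C_def a_def ln_mult ln_div field_simps)
  finally show "H - ln (1 + \<tau> * fisher) / 2 \<le> (LINT y|lborel. m y * ln (m y))"
    by (simp add: H_def field_simps)
qed

theorem fisher_entropy_decreasing: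
  "sqrt (LINT y|lborel. (m' y)\<^sup>2 / m y) * exp (- (LINT y|lborel. m y * ln (m y)))
    \<le> sqrt fisher * exp (- (LINT x|lborel. g x * ln (g x)))"
proof -
  have p: "0 < 1 + \<tau> * fisher"
    using fisher_nonneg \<tau> by (simp add: add_pos_nonneg)
  have "exp (- (LINT y|lborel. m y * ln (m y)))
      \<le> exp (ln (1 + \<tau> * fisher) / 2 - (LINT x|lborel. g x * ln (g x)))"
    using entropy_growth(2) by simp
  also have "\<dots> = sqrt (1 + \<tau> * fisher) * exp (- (LINT x|lborel. g x * ln (g x)))"
  proof -
    have "exp (ln (1 + \<tau> * fisher) / 2) = sqrt (1 + \<tau> * fisher)"
      using exp_ln[of "sqrt (1 + \<tau> * fisher)"] p by (simp add: ln_sqrt)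
    then show ?thesis by (simp only: exp_diff exp_minus divide_inverse)
  qed
  finally have "sqrt (LINT y|lborel. (m' y)\<^sup>2 / m y) * exp (- (LINT y|lborel. m y * ln (m y)))
      \<le> sqrt (fisher / (1 + \<tau> * fisher)) * (sqrt (1 + \<tau> * fisher) * exp (- (LINT x|lborel. g x * ln (g x))))"
    by (intro mult_mono real_sqrt_le_mono stam) (use fisher_nonneg p in auto)
  also have "\<dots> = sqrt fisher * exp (- (LINT x|lborel. g x * ln (g x)))"
    using p by (simp add: real_sqrt_divide)
  finally show ?thesis .
qed

end

end

section \<open>The Fisher-Shannon complexity of smooth densities\<close>

lemma nn_integral_finite_imp_integrable:
  fixes f :: "'a \<Rightarrow> real"
  assumes [measurable]: "f \<in> borel_measurable M"
    and "(\<integral>\<^sup>+x. ennreal (f x) \<partial>M) < \<infinity>" "(\<integral>\<^sup>+x. ennreal (- f x) \<partial>M) < \<infinity>"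
  shows "integrable M f"
  using assms by (auto simp: real_integrable_def less_top)

lemma shannon_power_eq:
  assumes "integrable lborel (\<lambda>x. g x * ln (g x))"
  shows "shannon_power g = ennreal (exp (- (LINT x|lborel. g x * ln (g x))))"
proof -
  let ?f = "\<lambda>x. g x * ln (g x)"
  obtain p n where p: "0 \<le> p" "(\<integral>\<^sup>+x. ennreal (?f x) \<partial>lborel) = ennreal p"
    and n: "0 \<le> n" "(\<integral>\<^sup>+x. ennreal (- ?f x) \<partial>lborel) = ennreal n"
    using assms by (cases "\<integral>\<^sup>+x. ennreal (?f x) \<partial>lborel"; cases "\<integral>\<^sup>+x. ennreal (- ?f x) \<partial>lborel")
      (auto simp: real_integrable_def)
  have "(LINT x|lborel. ?f x) = p - n"
    using real_lebesgue_integral_def[OF assms] p n by simp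
  then show ?thesis
    using p n by (simp add: shannon_power_def shannon_entropy_def)
qed

text \<open>A class on which the extended-valued complexity reduces to a real formula; it contains
  the Gaussians and the convolved densities.\<close>

locale smooth_density =
  fixes G G' :: "real \<Rightarrow> real"
  assumes pdf: "pdf G" and pos: "\<And>x. 0 < G x"
    and deriv: "\<And>x. (G has_real_derivative G' x) (at x)" and deriv_cont: "continuous_on UNIV G'"
    and ent: "integrable lborel (\<lambda>x. G x * ln (G x))"
    and fish: "integrable lborel (\<lambda>x. (G' x)\<^sup>2 / G x)"
begin

lemma cont: "continuous_on UNIV G"
  using DERIV_isCont[OF deriv] by (simp add: continuous_at_imp_continuous_on)

lemma meas [measurable]: "G \<in> borel_measurable borel" "G' \<in> borel_measurable borel"
  using cont deriv_cont by (auto intro: borel_measurable_continuous_onI)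

lemma complexity:
  "fisher_shannon G = ennreal (sqrt (LINT x|lborel. (G' x)\<^sup>2 / G x) * exp (- (LINT x|lborel. G x * ln (G x))))"
proof -
  have d: "deriv G = G'"
    using DERIV_imp_deriv[OF deriv] by (simp add: fun_eq_iff)
  have "locally_abs_continuous G"
    unfolding locally_abs_continuous_def d
  proof (intro allI impI conjI)
    fix a b :: real assume "a \<le> b"
    show "G' absolutely_integrable_on {a..b}"
      by (rule absolutely_integrable_continuous_real[OF continuous_on_subset[OF deriv_cont]]) simp
    show "integral {a..b} G' = G b - G a"
      using \<open>a \<le> b\<close> deriv
      by (intro integral_unique fundamental_theorem_of_calculus)
        (auto simp: has_real_derivative_iff_has_vector_derivative [symmetric] intro: has_field_derivative_at_within)
  qed
  then have "fisher_integral G = (\<integral>\<^sup>+x. ennreal ((G' x)\<^sup>2 / G x) \<partial>lborel)"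
    using pos by (auto simp: fisher_integral_def d nn_integral_completion power_divide power2_eq_square less_imp_neq [symmetric]
        intro!: nn_integral_cong arg_cong[where f = ennreal])
  also have "\<dots> = ennreal (LINT x|lborel. (G' x)\<^sup>2 / G x)"
    by (rule nn_integral_eq_integral[OF fish]) (use pos in \<open>auto simp: less_imp_le\<close>)
  finally have "phi21 G = ennreal (sqrt (LINT x|lborel. (G' x)\<^sup>2 / G x))"
    using pos by (simp add: phi21_def integral_nonneg_AE less_imp_le)
  then show ?thesis
    by (simp add: fisher_shannon_def shannon_power_eq[OF ent] ennreal_mult'')
qed

text \<open>Scaling by \<open>r\<close> multiplies the Fisher integral by r^2 and lowers the entropy
  by ln r, so the square root of the one cancels against the exponential of the other.\<close>

lemma affine:
  assumes r: "0 < r"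
  shows "smooth_density (\<lambda>t. r * G (r * (t - c))) (\<lambda>t. r\<^sup>2 * G' (r * (t - c)))"
    and "fisher_shannon (\<lambda>t. r * G (r * (t - c))) = fisher_shannon G"
proof -
  have aff: "r * (t - c) = - (r * c) + r * t" for t by (simp add: algebra_simps)
  have sub: "has_bochner_integral lborel (\<lambda>t. k (r * (t - c))) ((LINT x|lborel. k x) / r)"
    if "integrable lborel k" for k :: "real \<Rightarrow> real"
    using lborel_integrable_real_affine[OF that, of r "- (r * c)"]
      lborel_integral_real_affine[of r k "- (r * c)"] r
    by (simp add: aff has_bochner_integral_iff field_simps)
  have G: "integrable lborel G" "(LINT x|lborel. G x) = 1"
    using pdf by (auto simp: pdf_def has_bochner_integral_iff)
  have e: "has_bochner_integral lborel (\<lambda>t. r * G (r * (t - c)) * ln (r * G (r * (t - c))))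
      (ln r + (LINT x|lborel. G x * ln (G x)))"
  proof -
    have "has_bochner_integral lborel
        (\<lambda>t. r * ln r * G (r * (t - c)) + r * (G (r * (t - c)) * ln (G (r * (t - c)))))
        (r * ln r * (1 / r) + r * ((LINT x|lborel. G x * ln (G x)) / r))"
      using sub[OF G(1)] sub[OF ent] by (intro has_bochner_integral_add has_bochner_integral_mult_right) (simp_all add: G)
    moreover have "r * ln r * G (r * (t - c)) + r * (G (r * (t - c)) * ln (G (r * (t - c))))
        = r * G (r * (t - c)) * ln (r * G (r * (t - c)))" for t
      using r pos by (simp add: ln_mult algebra_simps)
    ultimately show ?thesis using r by simp
  qed
  have f: "has_bochner_integral lborel (\<lambda>t. (r\<^sup>2 * G' (r * (t - c)))\<^sup>2 / (r * G (r * (t - c))))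
      (r\<^sup>2 * (LINT x|lborel. (G' x)\<^sup>2 / G x))"
  proof -
    have "has_bochner_integral lborel (\<lambda>t. r ^ 3 * ((G' (r * (t - c)))\<^sup>2 / G (r * (t - c))))
        (r ^ 3 * ((LINT x|lborel. (G' x)\<^sup>2 / G x) / r))"
      by (intro has_bochner_integral_mult_right sub[OF fish])
    moreover have "r ^ 3 * ((G' (r * (t - c)))\<^sup>2 / G (r * (t - c)))
        = (r\<^sup>2 * G' (r * (t - c)))\<^sup>2 / (r * G (r * (t - c)))" for t
      using r by (simp add: power2_eq_square power3_eq_cube)
    ultimately show ?thesis using r by (simp add: power2_eq_square power3_eq_cube mult_ac)
  qed
  show S: "smooth_density (\<lambda>t. r * G (r * (t - c))) (\<lambda>t. r\<^sup>2 * G' (r * (t - c)))"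
  proof
    show "pdf (\<lambda>t. r * G (r * (t - c)))"
      using has_bochner_integral_mult_right[OF sub[OF G(1)], of r] r pos
      by (simp add: pdf_def G less_imp_le)
    show "0 < r * G (r * (t - c))" for t using r pos by simp
    show "((\<lambda>t. r * G (r * (t - c))) has_real_derivative r\<^sup>2 * G' (r * (t - c))) (at t)" for t
    proof -
      have "((\<lambda>t. r * (t - c)) has_real_derivative r) (at t)"
        by (auto intro!: derivative_eq_intros)
      from DERIV_cmult[OF DERIV_chain[OF deriv this], of r] show ?thesis
        by (simp add: comp_def power2_eq_square mult_ac)
    qed
    show "continuous_on UNIV (\<lambda>t. r\<^sup>2 * G' (r * (t - c)))"
      by (intro continuous_intros continuous_on_compose2[OF deriv_cont]) auto
  qed (use e f in \<open>auto simp: has_bochner_integral_iff\<close>)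
  have "sqrt (r\<^sup>2 * (LINT x|lborel. (G' x)\<^sup>2 / G x)) * exp (- (ln r + (LINT x|lborel. G x * ln (G x))))
      = sqrt (LINT x|lborel. (G' x)\<^sup>2 / G x) * exp (- (LINT x|lborel. G x * ln (G x)))"
  proof -
    have "exp (- (ln r + h)) = exp (- h) / r" for h
      using r by (simp add: exp_diff exp_minus divide_inverse)
    then show ?thesis using r by (simp add: real_sqrt_mult)
  qed
  then show "fisher_shannon (\<lambda>t. r * G (r * (t - c))) = fisher_shannon G"
    using smooth_density.complexity[OF S] complexity e f by (simp add: has_bochner_integral_iff)
qed

end

lemma smooth_density_gauss:
  assumes \<sigma>: "0 < \<sigma>"
  shows "smooth_density (gauss \<sigma>) (\<lambda>x. - (x / \<sigma>) * gauss \<sigma> x)"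
proof
  show "pdf (gauss \<sigma>)" by (rule pdf_gauss[OF \<sigma>])
  show "0 < gauss \<sigma> x" for x by (rule gauss_pos[OF \<sigma>])
  show "(gauss \<sigma> has_real_derivative - (x / \<sigma>) * gauss \<sigma> x) (at x)" for x by (rule gauss_deriv[OF \<sigma>])
  show "continuous_on UNIV (\<lambda>x. - (x / \<sigma>) * gauss \<sigma> x)"
    by (intro continuous_intros continuous_gauss[OF \<sigma>]) (use \<sigma> in auto)
  have "gauss \<sigma> x * ln (gauss \<sigma> x)
      = - ln (2 * pi * \<sigma>) / 2 * gauss \<sigma> x + - 1 / (2 * \<sigma>) * (x\<^sup>2 * gauss \<sigma> x)" for x
    by (simp add: ln_gauss[OF \<sigma>] algebra_simps)
  then show "integrable lborel (\<lambda>x. gauss \<sigma> x * ln (gauss \<sigma> x))"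
    by (simp only:) (intro Bochner_Integration.integrable_add integrable_mult_right
        gauss_integral gauss_second_moment \<sigma>)
  have "(- (x / \<sigma>) * gauss \<sigma> x)\<^sup>2 / gauss \<sigma> x = 1 / \<sigma>\<^sup>2 * (x\<^sup>2 * gauss \<sigma> x)" for x
    using gauss_pos[OF \<sigma>, of x] by (simp add: power2_eq_square field_simps)
  then show "integrable lborel (\<lambda>x. (- (x / \<sigma>) * gauss \<sigma> x)\<^sup>2 / gauss \<sigma> x)"
    by (simp only:) (intro integrable_mult_right gauss_second_moment \<sigma>)
qed

lemma gauss_scale:
  assumes "0 < \<sigma>" "0 < r"
  shows "r * gauss \<sigma> (r * x) = gauss (\<sigma> / r\<^sup>2) x"
  using assms by (simp add: gauss_def real_sqrt_divide power_mult_distrib field_simps)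

text \<open>Centred Gaussians are rescalings of one another. This is the source of the equality
  case, as the flow maps Gaussians to Gaussians.\<close>

lemma fisher_shannon_gauss:
  assumes \<sigma>: "0 < \<sigma>"
  shows "fisher_shannon (gauss \<sigma>) = fisher_shannon (gauss 1)"
proof -
  have "(\<lambda>t. 1 / sqrt \<sigma> * gauss 1 (1 / sqrt \<sigma> * (t - 0))) = gauss \<sigma>"
    using gauss_scale[of 1 "1 / sqrt \<sigma>"] \<sigma> by (simp add: power_divide fun_eq_iff)
  then show ?thesis
    using smooth_density.affine(2)[OF smooth_density_gauss[of 1], of "1 / sqrt \<sigma>" 0] \<sigma> by simp
qed

section \<open>Monotonicity of the complexity under the heat flow\<close>

lemma fisher_shannon_finiteD:
  assumes "fisher_shannon g \<noteq> \<top>"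
  shows "locally_abs_continuous g" "(\<integral>\<^sup>+x. ennreal (\<bar>deriv g x / g x\<bar>\<^sup>2 * g x) \<partial>lebesgue) \<noteq> \<top>"
    "fisher_shannon g = ennreal (sqrt (enn2real (\<integral>\<^sup>+x. ennreal (\<bar>deriv g x / g x\<bar>\<^sup>2 * g x) \<partial>lebesgue))) * shannon_power g"
  using assms
  by (auto simp: fisher_shannon_def phi21_def fisher_integral_def split: if_splits)

text \<open>The truncations to \<open>{- real n..real n}\<close> are integrable and converge
  pointwise. The result is Lebesgue measurability, so a Borel version of the derivative is chosen
  afterwards.\<close>

lemma locally_abs_continuous_measurable:
  assumes "locally_abs_continuous g"
  shows "deriv g \<in> borel_measurable lebesgue"
proof (rule borel_measurable_LIMSEQ_real)
  let ?s = "\<lambda>n x. indicator {- real n..real n} x *\<^sub>R deriv g x"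
  show "?s n \<in> borel_measurable lebesgue" for n
    using assms unfolding locally_abs_continuous_def set_integrable_def
    by (intro borel_measurable_integrable) (metis linear neg_le_0_iff_le of_nat_0_le_iff order_trans)
  show "(\<lambda>n. ?s n x) \<longlonglongrightarrow> deriv g x" for x
  proof (rule tendsto_eventually)
    obtain N where "\<bar>x\<bar> \<le> real N" using real_arch_simple by blast
    then have "\<forall>n\<ge>N. ?s n x = deriv g x" by (auto simp: indicator_def)
    then show "\<forall>\<^sub>F n in sequentially. ?s n x = deriv g x"
      by (auto simp: eventually_sequentially)
  qed
qed

text \<open>The passage from the extended-valued definitions to the real inequality: a finite
  product must be shown to have a finite Fisher integral and an integrable entropy
  integrand.\<close>

theorem fisher_shannon_gauss_conv:
  assumes \<tau>: "0 < \<tau>" and pdf: "pdf g" and zero: "AE x in lborel. g x = 0 \<longrightarrow> deriv g x = 0"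
    and fin: "fisher_shannon g \<noteq> \<top>"
  shows "\<exists>G'. smooth_density (gauss_conv \<tau> g) G'"
    and "fisher_shannon (gauss_conv \<tau> g) \<le> fisher_shannon g"
proof -
  have nonneg: "0 \<le> g x" for x using pdf by (simp add: pdf_def)
  have g_int: "integrable lborel g" "(LINT x|lborel. g x) = 1"
    using pdf by (auto simp: pdf_def has_bochner_integral_iff)
  have [measurable]: "g \<in> borel_measurable borel"
    using borel_measurable_integrable[OF g_int(1)] by simp
  note fin' = fisher_shannon_finiteD[OF fin]
  obtain d0 where d0 [measurable]: "d0 \<in> borel_measurable borel" and ae0: "AE x in lborel. deriv g x = d0 x"
    using completion_ex_borel_measurable_real[OF locally_abs_continuous_measurable[OF fin'(1)]] by auto
  \<comment> \<open>Resetting the Borel version on the zeros of \<open>g\<close> changes it only on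
    a null set, by \<open>zero\<close>.\<close>
  define d where "d = (\<lambda>x. if g x = 0 then 0 else d0 x)"
  have d_meas [measurable]: "d \<in> borel_measurable borel" unfolding d_def by measurable
  have ae: "AE x in lborel. deriv g x = d x"
    using ae0 zero by eventually_elim (simp add: d_def)
  have weak: "g b - g a = (LINT t|lborel. indicator {a..b} t * d t)" if "a \<le> b" for a b
  proof -
    have ai: "deriv g absolutely_integrable_on {a..b}" "integral {a..b} (deriv g) = g b - g a"
      using fin'(1) that by (auto simp: locally_abs_continuous_def)
    have "g b - g a = (LINT t:{a..b}|lebesgue. deriv g t)"
      using set_lebesgue_integral_eq_integral(2)[OF ai(1)] ai(2) by simp
    also have "\<dots> = (LINT t|lebesgue. indicator {a..b} t * d t)"
      unfolding set_lebesgue_integral_def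
    proof (rule integral_cong_AE)
      show "(\<lambda>t. indicator {a..b} t *\<^sub>R deriv g t) \<in> borel_measurable lebesgue"
        using ai(1) unfolding set_integrable_def by (rule borel_measurable_integrable)
      show "AE t in lebesgue. indicator {a..b} t *\<^sub>R deriv g t = indicator {a..b} t * d t"
        using AE_completion[OF ae] by eventually_elim simp
    qed (auto intro!: measurable_completion)
    also have "\<dots> = (LINT t|lborel. indicator {a..b} t * d t)"
      by (rule integral_completion) measurable
    finally show ?thesis .
  qed
  have "(\<integral>\<^sup>+x. ennreal (\<bar>deriv g x / g x\<bar>\<^sup>2 * g x) \<partial>lebesgue) = (\<integral>\<^sup>+x. ennreal ((d x)\<^sup>2 / g x) \<partial>lborel)"
    unfolding nn_integral_completion
    by (rule nn_integral_cong_AE) (use ae in eventually_elim, auto simp: power2_eq_square)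
  note fin'' = fin'(2,3)[unfolded this]
  have fisher_int: "integrable lborel (\<lambda>x. (d x)\<^sup>2 / g x)"
  proof (rule nn_integral_finite_imp_integrable)
    have "(\<integral>\<^sup>+x. ennreal (- ((d x)\<^sup>2 / g x)) \<partial>lborel) = (\<integral>\<^sup>+(x::real). 0 \<partial>lborel)"
      by (rule nn_integral_cong) (simp add: nonneg ennreal_neg)
    then show "(\<integral>\<^sup>+x. ennreal (- ((d x)\<^sup>2 / g x)) \<partial>lborel) < \<infinity>" by simp
  qed (use fin''(1) in \<open>auto simp: less_top\<close>)
  interpret fisher_density g d \<tau>
    using \<tau> nonneg g_int fisher_int weak by unfold_locales (auto simp: d_def)
  have I: "(\<integral>\<^sup>+x. ennreal ((d x)\<^sup>2 / g x) \<partial>lborel) = ennreal fisher"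
    unfolding fisher_def by (rule nn_integral_eq_integral[OF fisher_int]) (simp add: nonneg)
  \<comment> \<open>A zero factor would allow an infinite entropy power, since \<top> * 0 = 0. But
    zero Fisher information forces \<open>g\<close> to be constant, which no density on the line
    is.\<close>
  have fisher_pos: "0 < fisher"
  proof (rule ccontr)
    assume "\<not> 0 < fisher"
    then have "fisher = 0" using fisher_nonneg by simp
    then have "AE x in lborel. (d x)\<^sup>2 / g x = 0"
      unfolding fisher_def
      by (subst (asm) integral_nonneg_eq_0_iff_AE) (auto simp: fisher_int nonneg)
    then have d0: "AE x in lborel. d x = 0"
      by eventually_elim (auto simp: d_zero)
    have const: "g b = g a" if "a \<le> b" for a b
    proof -
      have "(LINT t|lborel. indicator {a..b} t * d t) = (LINT (t::real)|lborel. 0)"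
        by (rule integral_cong_AE) (use d0 in \<open>auto elim!: eventually_mono\<close>)
      then show ?thesis using weak[OF that] by simp
    qed
    have "g = (\<lambda>x. g 0)"
      using const[of 0] const[of _ 0] by (metis linear)
    then have "integrable lborel (\<lambda>x::real. g 0)"
      using g_int by metis
    then have "g 0 = 0" by (auto simp: integrable_iff_bounded ennreal_mult_less_top)
    with \<open>g = (\<lambda>x. g 0)\<close> have "g x = 0" for x by metis
    then show False using g_total by simp
  qed
  \<comment> \<open>As \<open>g\<close> is bounded, its entropy cannot be minus infinity.\<close>
  have ent_pos: "(\<integral>\<^sup>+x. ennreal (g x * ln (g x)) \<partial>lborel) < \<infinity>"
  proof -
    obtain M where M: "\<And>x. g x \<le> M" using g_bounded by blast
    have "g x * ln (g x) \<le> \<bar>ln M\<bar> * g x" for x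
    proof (cases "g x = 0")
      case False
      then have "0 < g x" using nonneg[of x] by simp
      then have "ln (g x) \<le> \<bar>ln M\<bar>" using M[of x] by (smt (verit) ln_mono)
      then show ?thesis using nonneg[of x] by (subst mult.commute) (rule mult_right_mono)
    qed simp
    then have "(\<integral>\<^sup>+x. ennreal (g x * ln (g x)) \<partial>lborel) \<le> (\<integral>\<^sup>+x. ennreal (\<bar>ln M\<bar> * g x) \<partial>lborel)"
      by (intro nn_integral_mono ennreal_leI)
    also have "\<dots> = ennreal (LINT x|lborel. \<bar>ln M\<bar> * g x)"
      by (rule nn_integral_eq_integral) (simp_all add: g_int nonneg)
    finally show ?thesis by (simp add: le_less_trans)
  qed
  have entropy_int: "integrable lborel (\<lambda>x. g x * ln (g x))"
  proof (rule nn_integral_finite_imp_integrable[OF _ ent_pos])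
    show "(\<integral>\<^sup>+x. ennreal (- (g x * ln (g x))) \<partial>lborel) < \<infinity>"
    proof (rule ccontr)
      assume "\<not> ?thesis"
      then have "(\<integral>\<^sup>+x. ennreal (- (g x * ln (g x))) \<partial>lborel) = \<top>" by (simp add: top.not_eq_extremum [symmetric])
      then have "shannon_entropy g = \<infinity>"
        by (simp add: shannon_entropy_def)
      then have "shannon_power g = \<top>" by (simp add: shannon_power_def)
      then have "fisher_shannon g = \<top>"
        using fin''(2) fisher_pos I by (simp add: ennreal_mult_eq_top_iff)
      with fin show False by simp
    qed
  qed measurable
  have eq: "gauss_conv \<tau> g = m" by (simp add: gauss_conv_def conv_def fun_eq_iff)
  have S: "smooth_density m m'"
  proof
    show "pdf m" using has_bochner_integral_m m_pos by (simp add: pdf_def less_imp_le)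
  qed (use m_pos m_deriv m'_continuous entropy_growth(1)[OF entropy_int] integrable_m_fisher in auto)
  then show "\<exists>G'. smooth_density (gauss_conv \<tau> g) G'" unfolding eq by blast
  have "fisher_shannon g = ennreal (sqrt fisher * exp (- (LINT x|lborel. g x * ln (g x))))"
    using fin''(2) I fisher_nonneg by (simp add: shannon_power_eq[OF entropy_int] ennreal_mult')
  then show "fisher_shannon (gauss_conv \<tau> g) \<le> fisher_shannon g"
    using smooth_density.complexity[OF S] fisher_entropy_decreasing[OF entropy_int]
    by (simp add: eq ennreal_leI)
qed

section \<open>The differential-escort transformation\<close>

locale escort_domain =
  fixes x\<^sub>i x\<^sub>f :: ereal and \<Omega> :: "real set" and h :: "real \<Rightarrow> real"
  assumes less: "x\<^sub>i < x\<^sub>f" and \<Omega>: "\<Omega> = einterval x\<^sub>i x\<^sub>f"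
    and h: "positive_pdf_on \<Omega> h" and h_cont: "continuous_on \<Omega> h"
begin

lemma open_\<Omega>: "open \<Omega>" by (simp add: \<Omega>)

lemma between_\<Omega>:
  assumes "a \<in> \<Omega>" "b \<in> \<Omega>" "a \<le> x" "x \<le> b"
  shows "x \<in> \<Omega>"
proof -
  have "x\<^sub>i < ereal a" "ereal b < x\<^sub>f" using assms(1,2) by (simp_all add: \<Omega> einterval_iff)
  moreover have "ereal a \<le> ereal x" "ereal x \<le> ereal b" using assms(3,4) by simp_all
  ultimately show ?thesis
    unfolding \<Omega> einterval_iff by (blast intro: less_le_trans le_less_trans)
qed

lemma convex_\<Omega>: "convex \<Omega>"
  unfolding is_interval_convex_1 [symmetric] is_interval_1 using between_\<Omega> by blast

lemma closure_\<Omega>: "closure \<Omega> \<subseteq> {x. x\<^sub>i \<le> ereal x \<and> ereal x \<le> x\<^sub>f}"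
proof (rule closure_minimal)
  show "closed {x. x\<^sub>i \<le> ereal x \<and> ereal x \<le> x\<^sub>f}"
    by (intro closed_Collect_conj closed_Collect_le continuous_intros)
qed (auto simp: \<Omega> einterval_iff)

text \<open>It recovers what the choice operators leave open: any solution they pick differs from a
  known one by a constant.\<close>

lemma constant_on_\<Omega>:
  assumes "\<And>x. x \<in> \<Omega> \<Longrightarrow> (u has_real_derivative w x) (at x)"
    and "\<And>x. x \<in> \<Omega> \<Longrightarrow> (v has_real_derivative w x) (at x)"
  obtains c where "\<And>x. x \<in> \<Omega> \<Longrightarrow> u x = v x + c"
proof -
  have "\<exists>c. \<forall>x\<in>\<Omega>. u x - v x = c"
  proof (rule has_field_derivative_zero_constant[OF convex_\<Omega>])
    show "((\<lambda>x. u x - v x) has_real_derivative 0) (at x within \<Omega>)" if "x \<in> \<Omega>" for x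
      using DERIV_diff[OF assms(1)[OF that] assms(2)[OF that]]
      by (simp add: has_field_derivative_at_within)
  qed
  then obtain c where "\<forall>x\<in>\<Omega>. u x - v x = c" by blast
  then show ?thesis by (intro that[of c]) (simp add: algebra_simps)
qed

lemma strict_mono_on_\<Omega>:
  assumes "\<And>x. x \<in> \<Omega> \<Longrightarrow> (u has_real_derivative w x) (at x)" "\<And>x. x \<in> \<Omega> \<Longrightarrow> 0 < w x"
  shows "strict_mono_on \<Omega> u"
proof (rule strict_mono_onI)
  fix a b assume ab: "a \<in> \<Omega>" "b \<in> \<Omega>" "a < b"
  have "\<exists>y. (u has_real_derivative y) (at x) \<and> 0 < y" if "a \<le> x" "x \<le> b" for x
    using assms between_\<Omega>[OF ab(1,2) that] by blast
  then show "u a < u b" using DERIV_pos_imp_increasing[OF ab(3)] by blast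
qed

lemma continuous_at_\<Omega>: "continuous_on \<Omega> u \<Longrightarrow> x \<in> \<Omega> \<Longrightarrow> isCont u x"
  using open_\<Omega> by (simp add: continuous_on_eq_continuous_at)

lemma h_positive: "x \<in> \<Omega> \<Longrightarrow> 0 < h x"
  using h by (simp add: positive_pdf_on_def)

text \<open>The support confines \<open>p\<close> to the closure of \<Omega> only, so the values at
  the endpoints are unknown; these form a null set.\<close>

lemma density_outside:
  assumes "positive_pdf_on \<Omega> p"
  shows "AE x in lborel. x \<notin> \<Omega> \<longrightarrow> p x = 0"
proof -
  have "negligible (frontier \<Omega>)" by (rule negligible_convex_frontier[OF convex_\<Omega>])
  then have "AE x in lborel. x \<notin> frontier \<Omega>"
    using AE_completion_iff[of _ lborel] AE_not_in negligible_iff_null_sets by blast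
  moreover have "p x = 0" if "x \<notin> \<Omega>" "x \<notin> frontier \<Omega>" for x
  proof -
    have "x \<notin> closure \<Omega>"
      using that open_\<Omega> by (simp add: frontier_def interior_open)
    then have "x \<notin> support p" using assms by (simp add: positive_pdf_on_def)
    then show ?thesis using closure_subset[of "{x. p x \<noteq> 0}"] by (auto simp: support_def)
  qed
  ultimately show ?thesis by (auto elim: eventually_mono)
qed

context
  fixes f :: "real \<Rightarrow> real" and \<alpha> :: real
  assumes f_pos: "\<And>x. x \<in> \<Omega> \<Longrightarrow> 0 < f x" and f_cont: "continuous_on \<Omega> f"
begin

lemma escort_coord_deriv:
  assumes "x \<in> \<Omega>"
  shows "(escort_coord \<Omega> h \<alpha> f has_real_derivative f x powr (1 - \<alpha>) * h x powr \<alpha>) (at x)"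
proof -
  have "\<exists>F. \<forall>x. x\<^sub>i < ereal x \<longrightarrow> ereal x < x\<^sub>f \<longrightarrow>
      (F has_vector_derivative f x powr (1 - \<alpha>) * h x powr \<alpha>) (at x)"
  proof (rule einterval_antiderivative[OF less])
    fix x assume "x\<^sub>i < ereal x" "ereal x < x\<^sub>f"
    then have "x \<in> \<Omega>" by (simp add: \<Omega> einterval_iff)
    then show "isCont (\<lambda>x. f x powr (1 - \<alpha>) * h x powr \<alpha>) x"
      using f_pos[of x] h_positive[of x]
      by (intro continuous_intros continuous_at_\<Omega> f_cont h_cont) auto
  qed
  then obtain F where "\<forall>x. x\<^sub>i < ereal x \<longrightarrow> ereal x < x\<^sub>f \<longrightarrow>
      (F has_vector_derivative f x powr (1 - \<alpha>) * h x powr \<alpha>) (at x)" ..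
  then have "\<forall>x\<in>\<Omega>. (F has_real_derivative f x powr (1 - \<alpha>) * h x powr \<alpha>) (at x)"
    by (intro ballI) (simp add: \<Omega> einterval_iff has_real_derivative_iff_has_vector_derivative)
  then have "\<exists>F. \<forall>x\<in>\<Omega>. (F has_real_derivative f x powr (1 - \<alpha>) * h x powr \<alpha>) (at x)"
    by blast
  from someI_ex[OF this] show ?thesis
    using assms unfolding escort_coord_def by blast
qed

lemma escort_coord_strict_mono: "strict_mono_on \<Omega> (escort_coord \<Omega> h \<alpha> f)"
proof (rule strict_mono_on_\<Omega>[OF escort_coord_deriv])
  show "0 < f x powr (1 - \<alpha>) * h x powr \<alpha>" if "x \<in> \<Omega>" for x
    using f_pos[OF that] h_positive[OF that] by simp
qed

lemma escort_coord_inj: "inj_on (escort_coord \<Omega> h \<alpha> f) \<Omega>"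
  using escort_coord_strict_mono by (rule strict_mono_on_imp_inj_on)

lemma rel_escort_at:
  assumes "x \<in> \<Omega>"
  shows "rel_escort \<Omega> h \<alpha> f (escort_coord \<Omega> h \<alpha> f x) = (f x / h x) powr \<alpha>"
  using assms by (simp add: rel_escort_def Let_def inv_into_f_f[OF escort_coord_inj])

lemma rel_escort_outside: "t \<notin> escort_coord \<Omega> h \<alpha> f ` \<Omega> \<Longrightarrow> rel_escort \<Omega> h \<alpha> f t = 0"
  by (simp add: rel_escort_def Let_def)

lemma escort_coord_image_interval: "is_interval (escort_coord \<Omega> h \<alpha> f ` \<Omega>)"
proof -
  have "continuous_on \<Omega> (escort_coord \<Omega> h \<alpha> f)"
    using escort_coord_deriv by (meson DERIV_isCont continuous_at_imp_continuous_on)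
  then show ?thesis
    using convex_\<Omega> by (simp add: is_interval_connected_1 connected_continuous_image convex_connected)
qed

text \<open>The change of variables in \<open>pdf_rel_escort\<close> yields integrability for
  \<open>lebesgue\<close>; Borel measurability has to come from continuity on the image
  interval.\<close>

lemma rel_escort_measurable: "rel_escort \<Omega> h \<alpha> f \<in> borel_measurable borel"
proof -
  let ?y = "escort_coord \<Omega> h \<alpha> f"
  let ?x = "inv_into \<Omega> ?y"
  have isCont_x: "isCont ?x t" if t: "t \<in> ?y ` \<Omega>" for t
  proof -
    obtain x where x: "x \<in> \<Omega>" "t = ?y x" using t by blast
    obtain e where e: "0 < e" "cball x e \<subseteq> \<Omega>" using open_contains_cball open_\<Omega> x(1) by blast
    have z: "z \<in> \<Omega>" if "\<bar>z - x\<bar> \<le> e" for z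
      using e(2) that by (auto simp: subset_iff dist_real_def abs_minus_commute)
    have "isCont ?x (?y x)"
      by (rule isCont_inverse_function[OF e(1)])
        (use z escort_coord_inj escort_coord_deriv in \<open>auto intro: DERIV_isCont\<close>)
    then show ?thesis using x by simp
  qed
  have "continuous_on (?y ` \<Omega>) (\<lambda>t. (f (?x t) / h (?x t)) powr \<alpha>)"
  proof -
    have c: "continuous_on (?y ` \<Omega>) ?x"
      using isCont_x by (simp add: continuous_at_imp_continuous_on)
    have im: "?x ` ?y ` \<Omega> \<subseteq> \<Omega>" by (auto intro: inv_into_into)
    have "h (?x t) \<noteq> 0" "f (?x t) \<noteq> 0" if "t \<in> ?y ` \<Omega>" for t
      using f_pos h_positive inv_into_into[OF that] by (metis less_irrefl)+
    then show ?thesis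
      by (intro continuous_intros continuous_on_compose2[OF f_cont c im]
          continuous_on_compose2[OF h_cont c im]) auto
  qed
  from borel_measurable_continuous_on_indicator[OF
      real_interval_borel_measurable[OF escort_coord_image_interval] this]
  have "(\<lambda>t. indicator (?y ` \<Omega>) t *\<^sub>R (f (?x t) / h (?x t)) powr \<alpha>) \<in> borel_measurable borel" .
  also have "(\<lambda>t. indicator (?y ` \<Omega>) t *\<^sub>R (f (?x t) / h (?x t)) powr \<alpha>) = rel_escort \<Omega> h \<alpha> f"
    by (auto simp: rel_escort_def Let_def fun_eq_iff)
  finally show ?thesis .
qed

text \<open>The transform is positive on the image interval and zero off it, so away from the null
  frontier every zero has a neighbourhood of zeros. This supplies the hypothesis \<open>zero\<close>
  of \<open>fisher_shannon_gauss_conv\<close>.\<close>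

lemma rel_escort_zero_deriv:
  "AE t in lborel. rel_escort \<Omega> h \<alpha> f t = 0 \<longrightarrow> deriv (rel_escort \<Omega> h \<alpha> f) t = 0"
proof -
  let ?J = "escort_coord \<Omega> h \<alpha> f ` \<Omega>"
  let ?g = "rel_escort \<Omega> h \<alpha> f"
  have "negligible (frontier ?J)"
    using escort_coord_image_interval by (simp add: is_interval_convex_1 negligible_convex_frontier)
  then have "AE t in lborel. t \<notin> frontier ?J"
    using AE_completion_iff[of _ lborel] AE_not_in negligible_iff_null_sets by blast
  moreover have "deriv ?g t = 0" if "t \<notin> frontier ?J" "?g t = 0" for t
  proof -
    have "t \<notin> ?J"
    proof
      assume "t \<in> ?J"
      then obtain x where "x \<in> \<Omega>" "t = escort_coord \<Omega> h \<alpha> f x" by blast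
      then show False using \<open>?g t = 0\<close> f_pos[of x] h_positive[of x] by (simp add: rel_escort_at)
    qed
    then have t: "t \<in> - closure ?J"
      using that(1) interior_subset[of ?J] by (auto simp: frontier_def)
    have "(?g has_real_derivative 0) (at t)"
    proof (rule has_field_derivative_transform_within_open[OF DERIV_const])
      show "open (- closure ?J)" by (rule open_Compl[OF closed_closure])
      show "0 = ?g s" if "s \<in> - closure ?J" for s
        using that closure_subset[of ?J] rel_escort_outside[of s] by auto
    qed (rule t)
    then show ?thesis by (rule DERIV_imp_deriv)
  qed
  ultimately show ?thesis by (auto elim: eventually_mono)
qed

lemma pdf_rel_escort:
  assumes f: "positive_pdf_on \<Omega> f"
  shows "pdf (rel_escort \<Omega> h \<alpha> f)"
proof -
  let ?y = "escort_coord \<Omega> h \<alpha> f"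
  let ?J = "?y ` \<Omega>"
  let ?g = "rel_escort \<Omega> h \<alpha> f"
  have fi: "integrable lborel f" "(LINT x|lborel. f x) = 1"
    using f by (auto simp: positive_pdf_on_def pdf_def has_bochner_integral_iff)
  have [measurable]: "f \<in> borel_measurable borel" "\<Omega> \<in> sets borel"
    using borel_measurable_integrable[OF fi(1)] open_\<Omega> by auto
  have fset: "set_integrable lborel \<Omega> f"
    unfolding set_integrable_def
    using integrable_indicator_mult[OF fi(1), of \<Omega>] open_\<Omega> by simp
  have "(LINT x:\<Omega>|lborel. f x) = (LINT x|lborel. f x)"
    unfolding set_lebesgue_integral_def
  proof (rule integral_cong_AE)
    show "AE x in lborel. indicator \<Omega> x *\<^sub>R f x = f x"
      using density_outside[OF f] by eventually_elim (auto simp: indicator_def)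
  qed measurable
  then have f1: "f absolutely_integrable_on \<Omega>" "integral \<Omega> f = 1"
    using fi set_borel_integral_eq_integral[OF fset] fset
    by (auto simp: set_integrable_def integrable_completion borel_measurable_integrable)
  have "(\<lambda>x. \<bar>f x powr (1 - \<alpha>) * h x powr \<alpha>\<bar> * ?g (?y x)) absolutely_integrable_on \<Omega> \<and>
      integral \<Omega> (\<lambda>x. \<bar>f x powr (1 - \<alpha>) * h x powr \<alpha>\<bar> * ?g (?y x)) = 1"
  proof -
    \<comment> \<open>The exponents are designed for this: the Jacobian times the transformed
      density is \<open>f\<close>, so mass is preserved.\<close>
    have "\<bar>f x powr (1 - \<alpha>) * h x powr \<alpha>\<bar> * ?g (?y x) = f x" if "x \<in> \<Omega>" for x
    proof -
      have "f x powr (1 - \<alpha>) * h x powr \<alpha> * (f x / h x) powr \<alpha> = f x powr (1 - \<alpha>) * f x powr \<alpha>"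
        using f_pos[OF that] h_positive[OF that] by (simp add: powr_divide)
      also have "\<dots> = f x"
        using f_pos[OF that] by (subst powr_add [symmetric]) simp
      finally show ?thesis by (simp add: rel_escort_at[OF that] abs_mult)
    qed
    then show ?thesis
      using f1 by (simp cong: set_integrable_cong integral_cong)
  qed
  then have g1: "?g absolutely_integrable_on ?J" "integral ?J ?g = 1"
    using has_absolute_integral_change_of_variables_1'[of \<Omega> ?y "\<lambda>x. f x powr (1 - \<alpha>) * h x powr \<alpha>" ?g 1]
      open_\<Omega> escort_coord_deriv escort_coord_inj
    by (auto intro: has_field_derivative_at_within)
  have ind: "indicator ?J t * ?g t = ?g t" for t
    using rel_escort_outside[of t] by (auto simp: indicator_def)
  have "integrable lebesgue ?g" "(LINT t|lebesgue. ?g t) = 1"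
    using g1 set_lebesgue_integral_eq_integral(2)[OF g1(1)]
    by (simp_all add: set_integrable_def set_lebesgue_integral_def ind)
  then have "has_bochner_integral lborel ?g 1"
    using rel_escort_measurable
    by (simp add: has_bochner_integral_iff integrable_completion integral_completion)
  moreover have "0 \<le> ?g t" for t by (simp add: rel_escort_def Let_def)
  ultimately show ?thesis by (simp add: pdf_def)
qed

end

section \<open>The inverse transformation\<close>

lemma h_int: "integrable lborel h" "(LINT x|lborel. h x) = 1" and h_nonneg: "0 \<le> h x"
  using h by (auto simp: positive_pdf_on_def pdf_def has_bochner_integral_iff)

lemma h_primitive_deriv: "x \<in> \<Omega> \<Longrightarrow> (primitive h has_real_derivative h x) (at x)"
  by (intro primitive_has_derivative h_int continuous_at_\<Omega> h_cont)

lemma h_zero: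
  assumes "\<not> (x\<^sub>i \<le> ereal x \<and> ereal x \<le> x\<^sub>f)"
  shows "h x = 0"
proof -
  have "x \<notin> support h"
    using h closure_\<Omega> assms unfolding positive_pdf_on_def by blast
  then show ?thesis
    using closure_subset[of "{x. h x \<noteq> 0}"] unfolding support_def by blast
qed

text \<open>Outside \<Omega> the distribution function of \<open>h\<close> is already 0 or 1. This
  gives surjectivity later: every value strictly in between is attained inside \<Omega>.\<close>

lemma h_primitive_range:
  assumes "0 < primitive h x" "primitive h x < 1"
  shows "x \<in> \<Omega>"
proof (rule ccontr)
  assume "x \<notin> \<Omega>"
  then have "\<not> x\<^sub>i < ereal x \<or> \<not> ereal x < x\<^sub>f" by (simp add: \<Omega> einterval_iff)
  then show False
  proof (elim disjE)
    assume 1: "\<not> x\<^sub>i < ereal x"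
    have "primitive h x = (LINT (t::real)|lborel. 0)"
      unfolding primitive_def
    proof (rule integral_cong_AE)
      show "AE t in lborel. indicator {..x} t * h t = 0"
        using AE_lborel_singleton[of x]
      proof eventually_elim
        case (elim t)
        show ?case
        proof (cases "t < x")
          case True
          then have "ereal t < x\<^sub>i" using 1 less_le_trans[of "ereal t" "ereal x" x\<^sub>i] by simp
          then have "\<not> (x\<^sub>i \<le> ereal t \<and> ereal t \<le> x\<^sub>f)" using leD by blast
          from h_zero[OF this] show ?thesis by simp
        qed (use elim in \<open>auto simp: indicator_def\<close>)
      qed
    qed (use borel_measurable_integrable[OF h_int(1)] in measurable)
    then show False using assms by simp
  next
    assume 2: "\<not> ereal x < x\<^sub>f"
    have "primitive h x = (LINT t|lborel. h t)"
      unfolding primitive_def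
    proof (rule Bochner_Integration.integral_cong)
      fix t
      show "indicator {..x} t * h t = h t"
      proof (cases "t \<le> x")
        case False
        then have "x\<^sub>f < ereal t" using 2 le_less_trans[of x\<^sub>f "ereal x" "ereal t"] by simp
        then have "\<not> (x\<^sub>i \<le> ereal t \<and> ereal t \<le> x\<^sub>f)" using leD by blast
        from h_zero[OF this] show ?thesis by simp
      qed simp
    qed simp
    then show False using assms h_int by simp
  qed
qed

lemma h_primitive_in:
  assumes "x \<in> \<Omega>"
  shows "0 < primitive h x" "primitive h x < 1"
proof -
  obtain e where e: "0 < e" "cball x e \<subseteq> \<Omega>" using open_contains_cball open_\<Omega> assms by blast
  then have "x - e \<in> \<Omega>" "x + e \<in> \<Omega>" by (auto simp: subset_iff dist_real_def)
  then have "primitive h (x - e) < primitive h x" "primitive h x < primitive h (x + e)"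
    using strict_mono_on_\<Omega>[OF h_primitive_deriv h_positive] assms e(1)
    by (auto simp: strict_mono_on_def)
  then show "0 < primitive h x" "primitive h x < 1"
    using primitive_bounds(1)[OF h_int(1) h_nonneg, of "x - e"]
      primitive_bounds(2)[OF h_int(1) h_nonneg, of "x + e"] h_int(2) by linarith+
qed

text \<open>
  Both \<open>(r G (r v)) powr s\<close> and \<open>h\<close> have mass one, so the differential equation for \<open>y\<close> says that
  \<open>y\<close> matches their distribution functions; hence \<open>y\<close> maps \<open>\<Omega>\<close> onto the whole line.
\<close>

theorem rel_escort_inv_rel_escort:
  assumes G: "positive_density G" and \<alpha>: "\<alpha> \<noteq> 0" "\<alpha> \<noteq> 1"
    and int: "integrable lborel (\<lambda>x. G x powr inv_conj \<alpha>)"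
  shows "\<exists>r>0. \<exists>c. rel_escort \<Omega> h \<alpha> (inv_rel_escort \<Omega> h \<alpha> G) = (\<lambda>t. r * G (r * (t - c)))"
proof -
  interpret G: positive_density G by (rule G)
  have G_ne: "G x \<noteq> 0" for x using G.pos[of x] by simp
  define s where "s = inv_conj \<alpha>"
  define r where "r = inv_scale \<alpha> G"
  define S where "S = (LINT x|lborel. G x powr s)"
  define w where "w = (\<lambda>v. (r * G (r * v)) powr s)"
  have s: "1 - s = 1 / \<alpha>" using \<alpha> by (simp add: s_def inv_conj_def field_simps)
  have S: "0 < S"
  proof -
    have "S \<noteq> 0"
    proof
      assume "S = 0"
      then have "AE x in lborel. G x powr s = 0"
        unfolding S_def
        by (subst (asm) integral_nonneg_eq_0_iff_AE) (use int in \<open>auto simp: s_def\<close>)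
      then have "AE x in lborel. G x = 0" by simp
      then have "(LINT x|lborel. G x) = (LINT (x::real)|lborel. 0)"
        by (intro integral_cong_AE) (auto intro: borel_measurable_continuous_onI[OF G.cont])
      then show False by (simp add: G.total)
    qed
    moreover have "0 \<le> S" unfolding S_def by (rule integral_nonneg_AE) simp
    ultimately show ?thesis by simp
  qed
  have r_eq: "r = S powr \<alpha>"
    using \<alpha> s by (simp add: r_def inv_scale_def renyi_power_def S_def s_def)
  then have r: "0 < r" using S by simp
  have w: "positive_density w"
  proof
    show "0 < w v" for v using r G.pos[of "r * v"] by (simp add: w_def)
    show "continuous_on UNIV w"
      unfolding w_def using r
      by (intro continuous_intros continuous_on_compose2[OF G.cont]) (auto simp: G_ne)
    have "w = (\<lambda>v. r powr s * G (0 + r * v) powr s)"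
      using r G.pos by (simp add: w_def powr_mult less_imp_le)
    moreover have "integrable lborel (\<lambda>v. G (0 + r * v) powr s)"
      using lborel_integrable_real_affine[OF int, of r 0] r by (simp add: s_def)
    moreover have "S = r * (LINT v|lborel. G (0 + r * v) powr s)"
      using lborel_integral_real_affine[of r "\<lambda>x. G x powr s" 0] r by (simp add: S_def)
    moreover have "r powr s * (S / r) = 1"
    proof -
      have "r powr s * (S / r) = r powr (s - 1) * S" using r by (simp add: powr_diff)
      also have "r powr (s - 1) = S powr (\<alpha> * (s - 1))" by (simp add: r_eq powr_powr)
      also have "\<alpha> * (s - 1) = - 1" using s \<alpha> by (simp add: field_simps)
      finally show ?thesis using S by (simp add: powr_minus)
    qed
    ultimately have "has_bochner_integral lborel w 1"
      using r by (auto simp: has_bochner_integral_iff field_simps)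
    then show "pdf w" by (simp add: pdf_def w_def)
  qed
  interpret w: positive_density w by (rule w)
  have w_neg: "(r * G (r * v)) powr (- s) = inverse (w v)" for v
    by (simp add: w_def powr_minus)
  define y where "y = inv_escort_coord \<Omega> h \<alpha> G"
  \<comment> \<open>The witness is the increasing rearrangement of \<open>h\<close> into
    \<open>w\<close>.\<close>
  have "\<exists>y. \<forall>x\<in>\<Omega>. 0 < G (r * y x) \<and> (y has_real_derivative (r * G (r * y x)) powr (- s) * h x) (at x)"
  proof (intro exI[of _ "\<lambda>x. w.quantile (primitive h x)"] ballI conjI G.pos)
    fix x assume x: "x \<in> \<Omega>"
    show "((\<lambda>x. w.quantile (primitive h x)) has_real_derivative
        (r * G (r * w.quantile (primitive h x))) powr (- s) * h x) (at x)"
      using DERIV_chain[OF w.quantile_deriv[OF h_primitive_in[OF x]] h_primitive_deriv[OF x]]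
      by (simp add: comp_def w_neg)
  qed
  from someI_ex[OF this] have y_deriv: "(y has_real_derivative (r * G (r * y x)) powr (- s) * h x) (at x)"
    if "x \<in> \<Omega>" for x
    using that unfolding y_def inv_escort_coord_def Let_def r_def s_def by blast
  have "((\<lambda>x. primitive w (y x)) has_real_derivative h x) (at x)" if "x \<in> \<Omega>" for x
    using DERIV_chain[OF w.deriv_primitive y_deriv[OF that]] w.pos[of "y x"]
    by (simp add: comp_def w_neg mult.assoc [symmetric])
  from constant_on_\<Omega>[OF this h_primitive_deriv]
  obtain k where k: "\<And>x. x \<in> \<Omega> \<Longrightarrow> primitive w (y x) = primitive h x + k" by blast
  have pdf_h: "pdf h" using h by (simp add: positive_pdf_on_def)
  have reach: "\<exists>x\<in>\<Omega>. primitive h x = v" if v: "0 < v" "v < 1" for v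
    using quantile_exists[OF pdf_h v] h_primitive_range v by metis
  have "k = 0"
  proof (rule ccontr)
    assume "k \<noteq> 0"
    \<comment> \<open>The chosen solution need not be the witness. A shift by \<open>k\<close> would
      keep the values of \<open>primitive h\<close>, which fill (0, 1), inside (0, 1); this
      \<open>v\<close> is one that a nonzero \<open>k\<close> moves out, and the cut at 1 / 2 keeps
      \<open>v\<close> itself inside.\<close>
    define v where "v = (if 0 < k then max (1 - k / 2) (1 / 2) else min (- k / 2) (1 / 2))"
    have v: "0 < v" "v < 1" "v + k \<ge> 1 \<or> v + k \<le> 0"
      using \<open>k \<noteq> 0\<close> by (auto simp: v_def max_def min_def split: if_splits)
    obtain x where "x \<in> \<Omega>" "primitive h x = v" using reach[OF v(1,2)] by blast
    then show False using k[of x] w.primitive_in[of "y x"] v(3) by linarith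
  qed
  \<comment> \<open>Surjectivity ensures that the default value 0 of \<open>rel_escort\<close> off
    the image is never taken.\<close>
  have y_surj: "\<exists>x\<in>\<Omega>. y x = t" for t
  proof -
    obtain x where x: "x \<in> \<Omega>" "primitive h x = primitive w t"
      using reach w.primitive_in by blast
    then have "primitive w (y x) = primitive w t" using k \<open>k = 0\<close> by simp
    then have "y x = t" using strict_mono_eq[OF w.strict_mono_primitive] by blast
    then show ?thesis using x by blast
  qed
  define f where "f = inv_rel_escort \<Omega> h \<alpha> G"
  have f_eq: "f x = (r * G (r * y x)) powr (1 / \<alpha>) * h x" if "x \<in> \<Omega>" for x
    using that by (simp add: f_def inv_rel_escort_def Let_def r_def y_def)
  have f_pos: "0 < f x" if "x \<in> \<Omega>" for x
    using r G.pos[of "r * y x"] h_positive[OF that] by (simp add: f_eq[OF that])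
  have f_cont: "continuous_on \<Omega> f"
  proof -
    have "continuous_on \<Omega> y" using y_deriv by (meson DERIV_isCont continuous_at_imp_continuous_on)
    then have "continuous_on \<Omega> (\<lambda>x. (r * G (r * y x)) powr (1 / \<alpha>) * h x)"
      using r
      by (intro continuous_intros continuous_on_compose2[OF G.cont] h_cont) (auto simp: G_ne)
    then show ?thesis by (rule continuous_on_eq) (simp add: f_eq)
  qed
  define Y where "Y = escort_coord \<Omega> h \<alpha> f"
  \<comment> \<open>The forward coordinate of the recovered density solves the equation of
    \<open>y\<close>, so the two differ by the translation \<open>c\<close>.\<close>
  have "(Y has_real_derivative (r * G (r * y x)) powr (- s) * h x) (at x)" if x: "x \<in> \<Omega>" for x
  proof -
    have p: "0 < r * G (r * y x)" using r G.pos by simp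
    have e: "1 / \<alpha> * (1 - \<alpha>) = - s" using \<alpha> by (simp add: s_def inv_conj_def field_simps)
    have "f x powr (1 - \<alpha>) * h x powr \<alpha> = (r * G (r * y x)) powr (- s) * (h x powr (1 - \<alpha>) * h x powr \<alpha>)"
    proof -
      have "((r * G (r * y x)) powr (1 / \<alpha>) * h x) powr (1 - \<alpha>)
          = ((r * G (r * y x)) powr (1 / \<alpha>)) powr (1 - \<alpha>) * h x powr (1 - \<alpha>)"
        using h_positive[OF x] by (intro powr_mult)
      then show ?thesis unfolding f_eq[OF x] powr_powr e by simp
    qed
    also have "h x powr (1 - \<alpha>) * h x powr \<alpha> = h x"
      using h_positive[OF x] by (subst powr_add [symmetric]) simp
    finally show ?thesis
      using escort_coord_deriv[OF f_pos f_cont x, of \<alpha>] by (simp add: Y_def)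
  qed
  from constant_on_\<Omega>[OF this y_deriv]
  obtain c where c: "\<And>x. x \<in> \<Omega> \<Longrightarrow> Y x = y x + c" by blast
  have "rel_escort \<Omega> h \<alpha> f t = r * G (r * (t - c))" for t
  proof -
    obtain x where x: "x \<in> \<Omega>" "y x = t - c" using y_surj by blast
    then have "t = Y x" using c by simp
    then have "rel_escort \<Omega> h \<alpha> f t = (f x / h x) powr \<alpha>"
      using rel_escort_at[OF f_pos f_cont x(1), of \<alpha>] by (simp add: Y_def)
    also have "\<dots> = r * G (r * y x)"
      using r G.pos[of "r * y x"] h_positive[OF x(1)] \<alpha> by (simp add: f_eq[OF x(1)] powr_powr)
    finally show ?thesis by (simp add: x)
  qed
  then show ?thesis using r by (auto simp: f_def)
qed

end

section \<open>Gaussian densities under the transformations\<close>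

lemma gauss_conv_gauss:
  assumes "0 < \<tau>" "0 < \<sigma>"
  shows "gauss_conv \<tau> (\<lambda>t. gauss \<sigma> (t - c)) = (\<lambda>t. gauss (\<tau> + \<sigma>) (t - c))"
proof
  fix x
  have "gauss_conv \<tau> (\<lambda>t. gauss \<sigma> (t - c)) x = (LINT t|lborel. gauss \<tau> (x - (c + t)) * gauss \<sigma> t)"
    unfolding gauss_conv_def
    using lborel_integral_real_affine[of 1 "\<lambda>t. gauss \<tau> (x - t) * gauss \<sigma> (t - c)" c] by simp
  also have "\<dots> = (LINT t|lborel. normal_density 0 (sqrt \<tau>) ((x - c) - t) * normal_density 0 (sqrt \<sigma>) t)"
    using assms by (simp add: gauss_eq_normal_density algebra_simps)
  also have "\<dots> = enn2real (\<integral>\<^sup>+t. ennreal (normal_density 0 (sqrt \<tau>) ((x - c) - t) * normal_density 0 (sqrt \<sigma>) t) \<partial>lborel)"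
    by (rule integral_eq_nn_integral) auto
  also have "\<dots> = normal_density 0 (sqrt (\<tau> + \<sigma>)) (x - c)"
    using fun_cong[OF conv_normal_density_zero_mean[of "sqrt \<tau>" "sqrt \<sigma>"], of "x - c"] assms by simp
  also have "\<dots> = gauss (\<tau> + \<sigma>) (x - c)"
    using assms by (simp add: gauss_eq_normal_density)
  finally show "gauss_conv \<tau> (\<lambda>t. gauss \<sigma> (t - c)) x = gauss (\<tau> + \<sigma>) (x - c)" .
qed

lemma (in smooth_density) positive_density: "positive_density G"
  by unfold_locales (rule pdf pos cont)+

text \<open>A density positive on the whole line has no compact support, which excludes \<alpha> = 1
  and leaves the integral form of \<open>inv_scale\<close>.\<close>

lemma inv_escort_definedD:
  assumes "inv_escort_defined \<alpha> G" and pos: "\<And>x. 0 < G x"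
  shows "\<alpha> \<noteq> 0" "\<alpha> \<noteq> 1" "integrable lborel (\<lambda>x. G x powr inv_conj \<alpha>)"
proof -
  have "{x. G x \<noteq> 0} = UNIV" using pos by (auto simp: less_imp_neq [symmetric])
  then have "\<not> compact (support G)"
    using compact_imp_bounded not_bounded_UNIV by (auto simp: support_def)
  then show "\<alpha> \<noteq> 0" "\<alpha> \<noteq> 1" "integrable lborel (\<lambda>x. G x powr inv_conj \<alpha>)"
    using assms(1) by (auto simp: inv_escort_defined_def split: if_splits)
qed

text \<open>Affine substitution transfers integrability from one Gaussian to another, so the
  admissible \<alpha> need not be determined.\<close>

lemma integrable_gauss_powr:
  assumes "0 < \<nu>" "0 < \<sigma>" and int: "integrable lborel (\<lambda>x. gauss \<nu> x powr s)"
  shows "integrable lborel (\<lambda>x. gauss \<sigma> (x - c) powr s)"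
proof -
  define k where "k = sqrt (\<nu> / \<sigma>)"
  have k: "0 < k" "\<nu> / k\<^sup>2 = \<sigma>" using assms by (simp_all add: k_def)
  have "gauss \<sigma> (x - c) powr s = k powr s * gauss \<nu> (- (k * c) + k * x) powr s" for x
    using gauss_scale[OF assms(1) k(1), of "x - c"] gauss_pos[OF assms(1)] k
    by (simp add: powr_mult [symmetric] less_imp_le algebra_simps)
  then show ?thesis
    using lborel_integrable_real_affine[OF int, of k "- (k * c)"] k(1) by simp
qed

theorem proposition4p1:
  fixes x\<^sub>i x\<^sub>f :: ereal and \<Omega> :: "real set" and h :: "real \<Rightarrow> real" and \<alpha> \<tau> :: real
  assumes "x\<^sub>i < x\<^sub>f" and "\<Omega> = einterval x\<^sub>i x\<^sub>f"
    and "positive_pdf_on \<Omega> h" and "continuous_on \<Omega> h"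
    and "0 < \<tau>"
  shows "(\<forall>f. positive_pdf_on \<Omega> f \<and> continuous_on \<Omega> f
              \<and> inv_escort_defined \<alpha> (gauss_conv \<tau> (rel_escort \<Omega> h \<alpha> f))
            \<longrightarrow> rel_fisher_shannon \<Omega> h \<alpha>
                  (inv_rel_escort \<Omega> h \<alpha> (gauss_conv \<tau> (rel_escort \<Omega> h \<alpha> f)))
                \<le> rel_fisher_shannon \<Omega> h \<alpha> f)
       \<and> (\<forall>f \<nu>. 0 < \<nu> \<and> inv_escort_defined \<alpha> (gauss \<nu>) \<and> f = inv_rel_escort \<Omega> h \<alpha> (gauss \<nu>)
            \<longrightarrow> rel_fisher_shannon \<Omega> h \<alpha>
                  (inv_rel_escort \<Omega> h \<alpha> (gauss_conv \<tau> (rel_escort \<Omega> h \<alpha> f)))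
                = rel_fisher_shannon \<Omega> h \<alpha> f)"
proof -
  interpret escort_domain x\<^sub>i x\<^sub>f \<Omega> h
    by unfold_locales (use assms in auto)
  have roundtrip: "rel_fisher_shannon \<Omega> h \<alpha> (inv_rel_escort \<Omega> h \<alpha> G) = fisher_shannon G"
    if S: "smooth_density G G'" and D: "\<alpha> \<noteq> 0" "\<alpha> \<noteq> 1" "integrable lborel (\<lambda>x. G x powr inv_conj \<alpha>)"
    for G G'
  proof -
    obtain r c where "0 < r" "rel_escort \<Omega> h \<alpha> (inv_rel_escort \<Omega> h \<alpha> G) = (\<lambda>t. r * G (r * (t - c)))"
      using rel_escort_inv_rel_escort[OF smooth_density.positive_density[OF S] D] by blast
    then show ?thesis
      using smooth_density.affine(2)[OF S] by (simp add: rel_fisher_shannon_def)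
  qed
  show ?thesis
  proof (intro conjI allI impI; elim conjE)
    fix f assume f: "positive_pdf_on \<Omega> f" "continuous_on \<Omega> f"
      and def: "inv_escort_defined \<alpha> (gauss_conv \<tau> (rel_escort \<Omega> h \<alpha> f))"
    let ?g = "rel_escort \<Omega> h \<alpha> f"
    have f_pos: "0 < f x" if "x \<in> \<Omega>" for x using f(1) that by (simp add: positive_pdf_on_def)
    show "rel_fisher_shannon \<Omega> h \<alpha> (inv_rel_escort \<Omega> h \<alpha> (gauss_conv \<tau> ?g)) \<le> rel_fisher_shannon \<Omega> h \<alpha> f"
    \<comment> \<open>An infinite right-hand side makes the bound trivial; a finite one provides the
      regularity of the transform that continuity of \<open>f\<close> alone does not.\<close>
    proof (cases "fisher_shannon ?g = \<top>")
      case False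
      note mono = fisher_shannon_gauss_conv[OF \<open>0 < \<tau>\<close> pdf_rel_escort[OF f_pos f(2,1)]
          rel_escort_zero_deriv[OF f_pos f(2)] False]
      obtain G' where S: "smooth_density (gauss_conv \<tau> ?g) G'" using mono(1) by blast
      show ?thesis
        using roundtrip[OF S inv_escort_definedD[OF def smooth_density.pos[OF S]]] mono(2)
        by (simp add: rel_fisher_shannon_def)
    qed (simp add: rel_fisher_shannon_def)
  next
    fix f and \<nu> :: real
    assume \<nu>: "0 < \<nu>" and def: "inv_escort_defined \<alpha> (gauss \<nu>)"
      and f: "f = inv_rel_escort \<Omega> h \<alpha> (gauss \<nu>)"
    note D = inv_escort_definedD[OF def gauss_pos[OF \<nu>]]
    obtain r c where r: "0 < r" and "rel_escort \<Omega> h \<alpha> f = (\<lambda>t. r * gauss \<nu> (r * (t - c)))"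
      using rel_escort_inv_rel_escort[OF positive_density_gauss[OF \<nu>] D] f by blast
    then have "rel_escort \<Omega> h \<alpha> f = (\<lambda>t. gauss (\<nu> / r\<^sup>2) (t - c))"
      using gauss_scale[OF \<nu>] by simp
    moreover define \<sigma> where "\<sigma> = \<tau> + \<nu> / r\<^sup>2"
    ultimately have conv: "gauss_conv \<tau> (rel_escort \<Omega> h \<alpha> f) = (\<lambda>t. gauss \<sigma> (t - c))"
      using gauss_conv_gauss[OF \<open>0 < \<tau>\<close>, of "\<nu> / r\<^sup>2" c] \<nu> r by simp
    have \<sigma>: "0 < \<sigma>" using \<open>0 < \<tau>\<close> \<nu> r by (simp add: \<sigma>_def add_pos_pos)
    note shift = smooth_density.affine[OF smooth_density_gauss[OF \<sigma>], of 1 c, simplified]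
    \<comment> \<open>The variances before and after the flow differ, so both sides are compared
      with the standard Gaussian.\<close>
    have "rel_fisher_shannon \<Omega> h \<alpha> (inv_rel_escort \<Omega> h \<alpha> (\<lambda>t. gauss \<sigma> (t - c))) = fisher_shannon (gauss 1)"
      using roundtrip[OF shift(1) D(1,2) integrable_gauss_powr[OF \<nu> \<sigma> D(3)]] shift(2)
        fisher_shannon_gauss[OF \<sigma>] by simp
    also have "\<dots> = rel_fisher_shannon \<Omega> h \<alpha> f"
      using roundtrip[OF smooth_density_gauss[OF \<nu>] D] fisher_shannon_gauss[OF \<nu>] f by simp
    finally show "rel_fisher_shannon \<Omega> h \<alpha> (inv_rel_escort \<Omega> h \<alpha> (gauss_conv \<tau> (rel_escort \<Omega> h \<alpha> f)))
        = rel_fisher_shannon \<Omega> h \<alpha> f"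
      unfolding conv .
  qed
qed

end
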